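(* Let $d\ge4$ and $1\le m\le d-3$ be integers. There is a constant $c_5>0$ depending only on $d$ such that the following holds. Let $\lambda>0$ be such that $$\chi:=e^{2\lambda}\Big(\frac md+\Big(1-\frac md\Big)q(d-m)\Big)<1 .$$ Then for every $u>0$, $$\limsup_{N\to\infty}\ \sup_{A\in\mathcal A_m}\ \frac1{|A|}\log\Big(E\Big[\exp\Big\{\lambda\sum_{x\in A}1\{H_x\le uN^d\}\Big\}\Big]\Big)\le c_5\,u\,\frac{e^{2\lambda}-1}{1-\chi},$$ (where $E[\cdot]$ is expectation under $P$), and there exist $N_1(d,m,\lambda)\ge1$ and $u_1(d,m,\lambda)>0$ such that for all $N\ge N_1$, $$P\big[X_{[0,u_1N^d]}\supseteq A\big]\le \exp\{-\lambda|A|\}\quad\text{for all }A\in\mathcal A_m .$$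
   Context: For $N\ge1$, $E=(\mathbb Z/N\mathbb Z)^d$ is the discrete torus, $\pi_E:\mathbb Z^d\to E$ the canonical projection, $e_1,\dots,e_d$ the canonical basis. $P$ is the law of simple random walk $(X_n)_{n\ge0}$ on $E$ (each step adds one of $\pm e_1,\dots,\pm e_d$ with probability $1/(2d)$) started from the uniform distribution. $X_{[0,t]}=\{X_n:0\le n\le t\}$ and $H_x=\inf\{n\ge0:X_n=x\}$. For $1\le m\le d$, $\mathcal L_m$ is the collection of sets $F=\pi_E\big(y+\sum_{i\in I}\mathbb Z e_i\big)$ with $y\in\mathbb Z^d$ and $I\subseteq\{1,\dots,d\}$, $|I|=m$; $\mathcal A_m$ is the collection of non-empty subsets $A\subseteq E$ such that $A\subseteq F$ for some $F\in\mathcal L_m$ (both depend on $N$). For an integer $\nu\ge1$, $q(\nu)$ is the probability that simple random walk on $\mathbb Z^\nu$ started at the origin returns to the origin at some time $n\ge1$. $|A|$ is the cardinality of $A$. *)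

theory Defs
  imports "HOL-Probability.Probability"
begin

text \<open>
  Points of \<open>\<int>\<^sup>d\<close> are integer sequences vanishing outside \<open>{..<d}\<close>; coordinates are numbered
  from 0, so the canonical basis \<open>e_1, \<dots>, e_d\<close> is \<open>unit_vec 0, \<dots>, unit_vec (d - 1)\<close>.
  The torus \<open>(\<int>/N\<int>)\<^sup>d\<close> is represented by the points with all coordinates in \<open>{0..<N}\<close>, and the
  canonical projection is coordinatewise reduction modulo \<open>N\<close>. Only \<open>N \<ge> 1\<close> is meaningful.
\<close>

definition lattice_points :: "nat \<Rightarrow> (nat \<Rightarrow> int) set" where
  "lattice_points d = {x. \<forall>i\<ge>d. x i = 0}"

definition torus :: "nat \<Rightarrow> nat \<Rightarrow> (nat \<Rightarrow> int) set" where
  "torus d N = {x \<in> lattice_points d. \<forall>i<d. 0 \<le> x i \<and> x i < int N}"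

definition torus_proj :: "nat \<Rightarrow> (nat \<Rightarrow> int) \<Rightarrow> nat \<Rightarrow> int" where
  "torus_proj N x = (\<lambda>i. x i mod int N)"

definition unit_vec :: "nat \<Rightarrow> nat \<Rightarrow> int" where
  "unit_vec i = (\<lambda>j. if j = i then 1 else 0)"

definition coord_subspaces :: "nat \<Rightarrow> nat \<Rightarrow> nat \<Rightarrow> (nat \<Rightarrow> int) set set" where
  "coord_subspaces d N m =
    {torus_proj N ` {(\<lambda>j. y j + (\<Sum>i\<in>I. k i * unit_vec i j)) | k. True} | y I.
      y \<in> lattice_points d \<and> I \<subseteq> {..<d} \<and> card I = m}"

definition coord_subsets :: "nat \<Rightarrow> nat \<Rightarrow> nat \<Rightarrow> (nat \<Rightarrow> int) set set" where
  "coord_subsets d N m =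
    {A. A \<noteq> {} \<and> A \<subseteq> torus d N \<and> (\<exists>F\<in>coord_subspaces d N m. A \<subseteq> F)}"

text \<open>
  The steps are drawn in \<open>\<int>\<^sup>d\<close>, where the \<open>2 * d\<close> vectors are distinct, and only the position is
  projected to the torus. So the weights are right also for \<open>N \<le> 2\<close>, where opposite steps coincide
  on the torus.
\<close>

definition step_pmf :: "nat \<Rightarrow> (nat \<Rightarrow> int) pmf" where
  "step_pmf d = pmf_of_set (\<Union>i<d. {unit_vec i, (\<lambda>j. - unit_vec i j)})"

definition steps_law :: "nat \<Rightarrow> (nat \<Rightarrow> nat \<Rightarrow> int) measure" where
  "steps_law d = (\<Pi>\<^sub>M n\<in>UNIV. measure_pmf (step_pmf d))"

definition displacement :: "(nat \<Rightarrow> nat \<Rightarrow> int) \<Rightarrow> nat \<Rightarrow> nat \<Rightarrow> int" where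
  "displacement \<xi> n = (\<lambda>i. \<Sum>k<n. \<xi> k i)"

definition return_prob :: "nat \<Rightarrow> real" where
  "return_prob \<nu> = \<P>(\<xi> in steps_law \<nu>. \<exists>n\<ge>1. displacement \<xi> n = (\<lambda>_. 0))"

text \<open>A sample point of the walk on the torus is a pair of a starting point and a step sequence.\<close>

type_synonym walk_sample = "(nat \<Rightarrow> int) \<times> (nat \<Rightarrow> nat \<Rightarrow> int)"

definition walk_law :: "nat \<Rightarrow> nat \<Rightarrow> walk_sample measure" where
  "walk_law d N = measure_pmf (pmf_of_set (torus d N)) \<Otimes>\<^sub>M steps_law d"

definition walk :: "nat \<Rightarrow> walk_sample \<Rightarrow> nat \<Rightarrow> nat \<Rightarrow> int" where
  "walk N \<omega> n = torus_proj N (\<lambda>i. fst \<omega> i + displacement (snd \<omega>) n i)"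

definition walk_range :: "nat \<Rightarrow> walk_sample \<Rightarrow> real \<Rightarrow> (nat \<Rightarrow> int) set" where
  "walk_range N \<omega> t = {walk N \<omega> n | n. real n \<le> t}"

text \<open>The infimum is taken in \<^typ>\<open>enat\<close>, hence \<open>\<infinity>\<close> for a point that is never visited.\<close>

definition hitting_time :: "nat \<Rightarrow> walk_sample \<Rightarrow> (nat \<Rightarrow> int) \<Rightarrow> enat" where
  "hitting_time N \<omega> x = Inf (enat ` {n. walk N \<omega> n = x})"

definition chi :: "nat \<Rightarrow> nat \<Rightarrow> real \<Rightarrow> real" where
  "chi d m l =
    exp (2 * l) * (real m / real d + (1 - real m / real d) * return_prob (d - m))"

end

theory Submission
  imports Defs
begin

text \<open>
  Cut the time interval into blocks of length \<open>N\<^sup>2\<close>. By the inequality of arithmetic and geometric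
  means it suffices to bound the exponential moment, with parameter \<open>2 * \<lambda>\<close>, of the visits made in
  every second block. The gaps between these blocks are long enough for the heat kernel to be at most
  \<open>C / N\<^sup>d\<close>, so each block hits \<open>A\<close> with probability \<open>O(|A| N\<^sup>2 / N\<^sup>d)\<close>, independently up to
  constants. Once in \<open>A\<close>, a further visit within the block requires a return to the coset containing
  \<open>A\<close>; its probability is close to \<open>m/d + (1 - m/d) q(d - m)\<close>, because the heat kernel of
  the transversal walk is \<open>O(n powr (-3/2) + N powr (-3))\<close> when \<open>d - m \<ge> 3\<close>. Hence the number of
  visits is dominated by a geometric variable, which yields the factor
  \<open>(exp (2 * \<lambda>) - 1) / (1 - \<chi>)\<close>. The second claim is Markov's inequality with a slightly larger
  \<open>\<lambda>\<close>.

  The walk is lifted to \<open>\<int>\<^sup>d\<close>, and functions on the torus become periodic functions.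
\<close>

subsection \<open>The averaging operator of the walk\<close>

text \<open>The block length \<open>N\<^sup>2\<close> meets two opposite needs. It is long enough
  that after one gap the full heat kernel has order 1/N^d, and short enough that the non-decaying
  term 1/N^3 of the transversal kernel adds only N^2/N^3 = 1/N to a return probability. A pair of
  blocks then contributes an excess weight of order |A| N^2/N^d, and there are about u N^d/(2 N^2)
  pairs, so N cancels and u |A| remains in the exponent.

  Counting visit times instead of visited points makes the functional a product over time, that is,
  an iterate of operators acting on functions; the Markov property becomes composition of operators,
  and no stopping times occur.

  The walk is not lazy, so eigenvalues near -1 decay as slowly as those near 1. Only upper bounds on
  the kernel are used, and both ends of the spectrum are treated alike at the price of a factor 2.

  The return probability exceeds its limit by a small error for finite N. Letting this error use up
  half of the room between \<chi> and 1 costs another factor 2, whatever m and \<lambda> are; so the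
  final constant depends on d alone.\<close>

definition nbr_up :: "(nat \<Rightarrow> int) \<Rightarrow> nat \<Rightarrow> nat \<Rightarrow> int" where
  "nbr_up x i = (\<lambda>j. x j + unit_vec i j)"

definition nbr_down :: "(nat \<Rightarrow> int) \<Rightarrow> nat \<Rightarrow> nat \<Rightarrow> int" where
  "nbr_down x i = (\<lambda>j. x j - unit_vec i j)"

definition nbr_avg :: "nat \<Rightarrow> ((nat \<Rightarrow> int) \<Rightarrow> real) \<Rightarrow> (nat \<Rightarrow> int) \<Rightarrow> real" where
  "nbr_avg d f x = (\<Sum>i<d. f (nbr_up x i) + f (nbr_down x i)) / (2 * real d)"

lemma nbr_lattice_points:
  assumes "x \<in> lattice_points d" "i < d"
  shows "nbr_up x i \<in> lattice_points d" "nbr_down x i \<in> lattice_points d"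
  using assms by (auto simp: lattice_points_def nbr_up_def nbr_down_def unit_vec_def)

lemma nbr_avg_mono_on:
  assumes "\<And>y. y \<in> lattice_points d \<Longrightarrow> f y \<le> g y" "x \<in> lattice_points d"
  shows "nbr_avg d f x \<le> nbr_avg d g x"
  unfolding nbr_avg_def
  by (intro divide_right_mono sum_mono add_mono assms nbr_lattice_points) auto

lemma nbr_avg_mono:
  assumes "\<And>y. f y \<le> g y"
  shows "nbr_avg d f x \<le> nbr_avg d g x"
  unfolding nbr_avg_def by (intro divide_right_mono sum_mono add_mono assms) auto

lemma nbr_avg_const: "d > 0 \<Longrightarrow> nbr_avg d (\<lambda>_. a) x = a"
  by (simp add: nbr_avg_def)

lemma nbr_avg_cmult: "nbr_avg d (\<lambda>x. a * f x) x = a * nbr_avg d f x"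
  unfolding nbr_avg_def by (simp add: sum_distrib_left ring_distribs)

lemma nbr_avg_cmult_right: "nbr_avg d (\<lambda>x. f x * a) x = nbr_avg d f x * a"
  using nbr_avg_cmult[of d a f x] by (simp add: mult.commute)

lemma nbr_avg_add: "nbr_avg d (\<lambda>x. f x + g x) x = nbr_avg d f x + nbr_avg d g x"
  unfolding nbr_avg_def by (simp add: sum.distrib add_divide_distrib)

lemma nbr_avg_diff: "nbr_avg d (\<lambda>x. f x - g x) x = nbr_avg d f x - nbr_avg d g x"
  unfolding nbr_avg_def
  by (simp add: sum.distrib sum_subtractf add_divide_distrib diff_divide_distrib)

lemma nbr_avg_sum:
  "nbr_avg d (\<lambda>x. \<Sum>y\<in>Y. f y x) x = (\<Sum>y\<in>Y. nbr_avg d (f y) x)"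
proof (induction Y rule: infinite_finite_induct)
  case (insert y Y)
  then show ?case by (simp add: nbr_avg_add)
qed (simp_all add: nbr_avg_def)

lemma nbr_avg_pow_mono_on:
  assumes "\<And>y. y \<in> lattice_points d \<Longrightarrow> f y \<le> g y" "x \<in> lattice_points d"
  shows "(nbr_avg d ^^ n) f x \<le> (nbr_avg d ^^ n) g x"
  using assms(2)
proof (induction n arbitrary: x)
  case (Suc n)
  then show ?case by (auto intro!: nbr_avg_mono_on)
qed (simp add: assms)

lemma nbr_avg_pow_const: "d > 0 \<Longrightarrow> (nbr_avg d ^^ n) (\<lambda>_. a) = (\<lambda>_. a)"
  by (induction n) (auto simp: nbr_avg_const)

lemma nbr_avg_pow_sum:
  "(nbr_avg d ^^ n) (\<lambda>x. \<Sum>y\<in>Y. f y x) = (\<lambda>x. \<Sum>y\<in>Y. (nbr_avg d ^^ n) (f y) x)"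
  by (induction n) (auto simp: nbr_avg_sum)

lemma nbr_avg_pow_cmult:
  "(nbr_avg d ^^ n) (\<lambda>x. a * f x) = (\<lambda>x. a * (nbr_avg d ^^ n) f x)"
  by (induction n) (auto simp: nbr_avg_cmult)

lemma nbr_avg_pow_add:
  "(nbr_avg d ^^ n) (\<lambda>x. f x + g x) = (\<lambda>x. (nbr_avg d ^^ n) f x + (nbr_avg d ^^ n) g x)"
  by (induction n) (auto simp: nbr_avg_add)

text \<open>The codomain is left open so that the notion covers sets as well, through their
  membership predicates.\<close>

definition periodic :: "nat \<Rightarrow> ((nat \<Rightarrow> int) \<Rightarrow> 'a) \<Rightarrow> bool" where
  "periodic N f \<longleftrightarrow> (\<forall>x. f (torus_proj N x) = f x)"

lemma periodicD: "periodic N f \<Longrightarrow> f (torus_proj N x) = f x"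
  by (simp add: periodic_def)

lemma torus_proj_nbr:
  "torus_proj N (nbr_up (torus_proj N x) i) = torus_proj N (nbr_up x i)"
  "torus_proj N (nbr_down (torus_proj N x) i) = torus_proj N (nbr_down x i)"
  by (auto simp: torus_proj_def nbr_up_def nbr_down_def mod_simps)

lemma periodic_nbr_avg:
  assumes "periodic N f"
  shows "periodic N (nbr_avg d f)"
proof -
  have "f (nbr_up (torus_proj N x) i) = f (nbr_up x i)"
    "f (nbr_down (torus_proj N x) i) = f (nbr_down x i)" for x i
    using periodicD[OF assms, of "nbr_up (torus_proj N x) i"]
      periodicD[OF assms, of "nbr_up x i"]
      periodicD[OF assms, of "nbr_down (torus_proj N x) i"]
      periodicD[OF assms, of "nbr_down x i"]
    by (simp_all add: torus_proj_nbr)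
  then show ?thesis
    unfolding periodic_def nbr_avg_def by simp
qed

section \<open>Invariance of the uniform distribution on the torus\<close>

lemma finite_torus: "finite (torus d N)"
proof -
  have "finite {f. \<forall>x. (x \<in> {..<d} \<longrightarrow> f x \<in> {0..<int N}) \<and> (x \<notin> {..<d} \<longrightarrow> f x = (0::int))}"
    by (rule finite_set_of_finite_funs) auto
  then show ?thesis
    by (rule rev_finite_subset) (auto simp: torus_def lattice_points_def)
qed

lemma torus_nonempty: "N > 0 \<Longrightarrow> torus d N \<noteq> {}"
  by (auto simp: torus_def lattice_points_def intro!: exI[of _ "\<lambda>_. 0"])

lemma torus_subset_lattice: "torus d N \<subseteq> lattice_points d"
  by (auto simp: torus_def)

lemma torus_proj_in_torus:
  "N > 0 \<Longrightarrow> x \<in> lattice_points d \<Longrightarrow> torus_proj N x \<in> torus d N"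
  by (auto simp: torus_def torus_proj_def lattice_points_def)

lemma torus_proj_id: "x \<in> torus d N \<Longrightarrow> torus_proj N x = x"
proof (rule ext)
  fix i assume "x \<in> torus d N"
  then show "torus_proj N x i = x i"
    by (cases "i < d") (auto simp: torus_def lattice_points_def torus_proj_def)
qed

lemma sum_torus_nbr:
  assumes per: "periodic N f" and "N > 0" "i < d"
  shows "(\<Sum>x\<in>torus d N. f (nbr_up x i)) = (\<Sum>x\<in>torus d N. f x)"
    "(\<Sum>x\<in>torus d N. f (nbr_down x i)) = (\<Sum>x\<in>torus d N. f x)"
proof -
  have *: "torus_proj N (nbr_down (torus_proj N (nbr_up x i)) i) = x"
       "torus_proj N (nbr_up (torus_proj N (nbr_down x i)) i) = x" if "x \<in> torus d N" for x
    using torus_proj_id[OF that]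
    by (auto simp: torus_proj_nbr) (auto simp: nbr_up_def nbr_down_def)
  have **: "torus_proj N (nbr_up x i) \<in> torus d N" "torus_proj N (nbr_down x i) \<in> torus d N"
    if "x \<in> torus d N" for x
    using that nbr_lattice_points[of x d i] torus_proj_in_torus assms torus_subset_lattice by blast+
  show "(\<Sum>x\<in>torus d N. f (nbr_up x i)) = (\<Sum>x\<in>torus d N. f x)"
    by (rule sum.reindex_bij_witness[where i = "\<lambda>x. torus_proj N (nbr_down x i)"
          and j = "\<lambda>x. torus_proj N (nbr_up x i)"])
      (use * ** per in \<open>auto simp: periodicD\<close>)
  show "(\<Sum>x\<in>torus d N. f (nbr_down x i)) = (\<Sum>x\<in>torus d N. f x)"
    by (rule sum.reindex_bij_witness[where i = "\<lambda>x. torus_proj N (nbr_up x i)"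
          and j = "\<lambda>x. torus_proj N (nbr_down x i)"])
      (use * ** per in \<open>auto simp: periodicD\<close>)
qed

text \<open>Stationarity of the uniform law: each shift by a basis vector permutes the torus. It
  serves both to sum the excess weight of a block over all starting points and to shift the block
  pattern in time.\<close>

lemma sum_torus_nbr_avg:
  assumes "periodic N f" "N > 0" "d > 0"
  shows "(\<Sum>x\<in>torus d N. nbr_avg d f x) = (\<Sum>x\<in>torus d N. f x)"
proof -
  have "(\<Sum>x\<in>torus d N. nbr_avg d f x)
      = (\<Sum>i<d. \<Sum>x\<in>torus d N. f (nbr_up x i) + f (nbr_down x i)) / (2 * real d)"
    unfolding nbr_avg_def sum_divide_distrib[symmetric] by (subst sum.swap) simp
  also have "\<dots> = (\<Sum>i<d. 2 * (\<Sum>x\<in>torus d N. f x)) / (2 * real d)"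
    by (intro arg_cong2[where f = "(/)"] sum.cong refl)
      (simp add: sum.distrib sum_torus_nbr assms)
  also have "\<dots> = (\<Sum>x\<in>torus d N. f x)"
    using assms by simp
  finally show ?thesis .
qed

subsection \<open>Weighted path functionals and hitting probabilities\<close>

text \<open>A Feynman-Kac operator: applied to the constant 1 it gives the expectation, from x, of
  the product of factors \<open>c\<close> over the marked times at which the walk is in S. The
  factor belongs to the position before the step, so the first entry of \<open>bs\<close> refers to
  time 0 and the final position carries no factor.\<close>

definition path_op ::
  "nat \<Rightarrow> real \<Rightarrow> (nat \<Rightarrow> int) set \<Rightarrow> bool list \<Rightarrow> ((nat \<Rightarrow> int) \<Rightarrow> real) \<Rightarrow> (nat \<Rightarrow> int) \<Rightarrow> real"
  where
  "path_op d c S bs g = foldr (\<lambda>b g x. (if b \<and> x \<in> S then c else 1) * nbr_avg d g x) bs g"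

lemma path_op_Nil [simp]: "path_op d c S [] g = g"
  by (simp add: path_op_def)

lemma path_op_Cons:
  "path_op d c S (b # bs) g x = (if b \<and> x \<in> S then c else 1) * nbr_avg d (path_op d c S bs g) x"
  by (simp add: path_op_def)

lemma path_op_append: "path_op d c S (bs @ bs') g = path_op d c S bs (path_op d c S bs' g)"
  by (simp add: path_op_def)

lemma path_op_False: "path_op d c S (replicate n False) g = (nbr_avg d ^^ n) g"
proof (induction n)
  case (Suc n)
  then show ?case by (intro ext) (simp add: path_op_Cons)
qed simp

lemma path_op_mono_on:
  assumes "c \<ge> 0" "\<And>y. y \<in> lattice_points d \<Longrightarrow> f y \<le> g y" "x \<in> lattice_points d"
  shows "path_op d c S bs f x \<le> path_op d c S bs g x"
  using assms(3)
proof (induction bs arbitrary: x)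
  case (Cons b bs)
  then show ?case using assms(1)
    by (auto simp: path_op_Cons intro!: nbr_avg_mono_on mult_left_mono)
qed (simp add: assms)

lemma path_op_cmult: "path_op d c S bs (\<lambda>x. a * f x) = (\<lambda>x. a * path_op d c S bs f x)"
  by (induction bs) (auto simp: path_op_Cons nbr_avg_cmult)

lemma path_op_ge_1:
  assumes "d > 0" "c \<ge> 1"
  shows "path_op d c S bs (\<lambda>_. 1) x \<ge> 1"
proof (induction bs arbitrary: x)
  case (Cons b bs)
  have "nbr_avg d (\<lambda>_. 1) x \<le> nbr_avg d (path_op d c S bs (\<lambda>_. 1)) x"
    by (intro nbr_avg_mono Cons)
  then have ge: "1 \<le> nbr_avg d (path_op d c S bs (\<lambda>_. 1)) x"
    using assms by (simp add: nbr_avg_const)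
  then have "1 * 1 \<le> c * nbr_avg d (path_op d c S bs (\<lambda>_. 1)) x"
    using assms by (intro mult_mono) auto
  then show ?case using ge by (simp add: path_op_Cons)
qed simp

lemma periodic_path_op:
  assumes "periodic N g" "periodic N (\<lambda>x. x \<in> S)"
  shows "periodic N (path_op d c S bs g)"
proof (induction bs)
  case (Cons b bs)
  show ?case
    using periodic_nbr_avg[OF Cons, of d] assms(2)
    by (auto simp: periodic_def path_op_Cons)
qed (simp add: assms)

text \<open>The probability that one of the positions at times 0, ..., k - 1 lies in S. Time 0
  counts, so a genuine return within k steps is \<open>nbr_avg d (hit d S k) x\<close>.\<close>

primrec hit :: "nat \<Rightarrow> (nat \<Rightarrow> int) set \<Rightarrow> nat \<Rightarrow> (nat \<Rightarrow> int) \<Rightarrow> real" where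
  "hit d S 0 = (\<lambda>x. 0)"
| "hit d S (Suc k) = (\<lambda>x. if x \<in> S then 1 else nbr_avg d (hit d S k) x)"

lemma hit_nonneg: "hit d S k x \<ge> 0"
  by (induction k arbitrary: x) (auto simp: nbr_avg_def intro!: divide_nonneg_nonneg sum_nonneg)

lemma hit_le_1: "d > 0 \<Longrightarrow> hit d S k x \<le> 1"
proof (induction k arbitrary: x)
  case (Suc k)
  then have "nbr_avg d (hit d S k) x \<le> nbr_avg d (\<lambda>_. 1) x"
    by (intro nbr_avg_mono) auto
  then show ?case using Suc by (simp add: nbr_avg_const)
qed simp

lemma hit_le_Suc: "hit d S k x \<le> hit d S (Suc k) x"
proof (induction k arbitrary: x)
  case 0
  show ?case using hit_nonneg[of d S 1 x] by simp
next
  case (Suc k)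
  then have "nbr_avg d (hit d S k) x \<le> nbr_avg d (hit d S (Suc k)) x"
    by (intro nbr_avg_mono) auto
  then show ?case by simp
qed

text \<open>The iterated average is the probability of being in S at time k, the only time that the
  longer horizon adds.\<close>

lemma hit_Suc_union_bound:
  "hit d S (Suc k) x \<le> hit d S k x + (nbr_avg d ^^ k) (indicator S) x"
proof (induction k arbitrary: x)
  case 0
  then show ?case by (auto simp: nbr_avg_def)
next
  case (Suc k)
  have *: "(nbr_avg d ^^ k) (indicator S) x \<ge> 0" for k x
    by (induction k arbitrary: x) (auto simp: nbr_avg_def intro!: divide_nonneg_nonneg sum_nonneg)
  have "nbr_avg d (hit d S (Suc k)) x
      \<le> nbr_avg d (\<lambda>x. hit d S k x + (nbr_avg d ^^ k) (indicator S) x) x"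
    by (intro nbr_avg_mono Suc)
  then show ?case using *[of "Suc k" x] by (auto simp: nbr_avg_add)
qed

lemma hit_union_bound:
  assumes "n \<le> k"
  shows "hit d S k x \<le> hit d S n x + (\<Sum>t=n..<k. (nbr_avg d ^^ t) (indicator S) x)"
  using assms
proof (induction k rule: dec_induct)
  case (step k)
  then show ?case using hit_Suc_union_bound[of d S k x] by (simp del: hit.simps)
qed simp

text \<open>The geometric domination, in the form of an induction on the horizon. The excess weight
  after the first hit of F is at most M, the sum of the geometric series with ratio c \<rho>. Hits
  are measured on the larger set F, whose return probability is known; a point of F outside S only
  makes the bound more generous.\<close>

lemma visit_weight_le_hit:
  assumes "d > 0" "S \<subseteq> F" "c \<ge> 1" "c * \<rho> < 1"
    and \<rho>: "\<And>x j. x \<in> S \<Longrightarrow> j < k \<Longrightarrow> nbr_avg d (hit d F j) x \<le> \<rho>"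
  shows "path_op d c S (replicate k True) (\<lambda>_. 1) y - 1 \<le> hit d F k y * ((c - 1) / (1 - c * \<rho>))"
  using \<rho>
proof (induction k arbitrary: y)
  case (Suc k)
  let ?M = "(c - 1) / (1 - c * \<rho>)"
  let ?b = "path_op d c S (replicate k True) (\<lambda>_. 1)"
  have M: "?M \<ge> 0" using assms by auto
  have IH: "?b z - 1 \<le> hit d F k z * ?M" for z
    using Suc.IH[of z] Suc.prems by auto
  have "nbr_avg d (\<lambda>z. ?b z - 1) y \<le> nbr_avg d (\<lambda>z. hit d F k z * ?M) y"
    by (intro nbr_avg_mono IH)
  then have le: "nbr_avg d ?b y - 1 \<le> nbr_avg d (hit d F k) y * ?M"
    using nbr_avg_diff[of d ?b "\<lambda>_. 1" y] nbr_avg_const[of d 1 y] nbr_avg_cmult_right[of d "hit d F k" ?M y] assms(1)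
    by simp
  consider "y \<in> S" | "y \<notin> S" "y \<in> F" | "y \<notin> F" by auto
  then show ?case
  proof cases
    case 1
    have "nbr_avg d ?b y - 1 \<le> \<rho> * ?M"
      using le Suc.prems[OF 1, of k] M by (meson lessI mult_right_mono order_trans)
    then have "c * (nbr_avg d ?b y - 1) \<le> c * (\<rho> * ?M)"
      using assms by (intro mult_left_mono) auto
    \<comment> \<open>The fixed point equation that determines M: a visit contributes c - 1 at once,
      and with probability at most \<rho> a further excess M, scaled by c.\<close>
    moreover have "c - 1 + c * (\<rho> * ?M) = ?M"
      using assms by (simp add: field_simps)
    ultimately have "c * nbr_avg d ?b y - 1 \<le> ?M"
      by (simp add: algebra_simps)
    then show ?thesis using 1 assms by (auto simp: path_op_Cons)
  next
    case 2
    have "nbr_avg d (hit d F k) y \<le> nbr_avg d (\<lambda>_. 1) y"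
      by (intro nbr_avg_mono hit_le_1 assms)
    then have "nbr_avg d (hit d F k) y * ?M \<le> 1 * ?M"
      using assms(1) M by (intro mult_right_mono) (auto simp: nbr_avg_const)
    then show ?thesis using le 2 by (auto simp: path_op_Cons)
  next
    case 3
    then show ?thesis using le assms(2) by (auto simp: path_op_Cons)
  qed
qed simp

text \<open>Each additional time step costs at most M for every starting point in A; at other
  starting points the excess is merely averaged, which by stationarity leaves its sum unchanged.
  This is where the factor |A| N^2 of a block arises.\<close>

lemma sum_visit_weight_le:
  assumes "d > 0" "N > 0" "A \<subseteq> torus d N" "c \<ge> 1" "M \<ge> 0"
    and S: "S = {x. torus_proj N x \<in> A}"
    and M: "\<And>x j. x \<in> S \<Longrightarrow> j \<le> k \<Longrightarrow> path_op d c S (replicate j True) (\<lambda>_. 1) x - 1 \<le> M"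
  shows "(\<Sum>x\<in>torus d N. path_op d c S (replicate k True) (\<lambda>_. 1) x - 1) \<le> real k * real (card A) * M"
  using M
proof (induction k)
  case (Suc k)
  let ?b = "path_op d c S (replicate k True) (\<lambda>_. 1)"
  let ?b' = "path_op d c S (replicate (Suc k) True) (\<lambda>_. 1)"
  have b: "?b x \<ge> 1" for x
    by (rule path_op_ge_1) fact+
  have per: "periodic N (\<lambda>x. x \<in> S)"
    by (auto simp: S periodic_def torus_proj_def)
  have "nbr_avg d (\<lambda>_. 1) x \<le> nbr_avg d ?b x" for x
    by (intro nbr_avg_mono b)
  then have b2: "nbr_avg d ?b x \<ge> 1" for x
    using assms by (simp add: nbr_avg_const)
  have "?b' x - 1 \<le> (nbr_avg d ?b x - 1) + (if x \<in> A then M else 0)" if "x \<in> torus d N" for x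
  proof (cases "x \<in> A")
    case True
    then have "x \<in> S" using S torus_proj_id[OF that] by simp
    then show ?thesis using Suc.prems[of x "Suc k"] b2[of x] True by simp
  next
    case False
    then have "x \<notin> S" using S torus_proj_id[OF that] by simp
    then show ?thesis using False by (simp add: path_op_Cons)
  qed
  then have "(\<Sum>x\<in>torus d N. ?b' x - 1)
      \<le> (\<Sum>x\<in>torus d N. (nbr_avg d ?b x - 1) + (if x \<in> A then M else 0))"
    by (intro sum_mono)
  also have "\<dots> = (\<Sum>x\<in>torus d N. nbr_avg d ?b x - 1) + (\<Sum>x\<in>torus d N. if x \<in> A then M else 0)"
    by (rule sum.distrib)
  also have "(\<Sum>x\<in>torus d N. if x \<in> A then M else 0) = real (card A) * M"
    using assms(3) finite_torus[of d N] by (simp add: sum.If_cases Int_absorb1)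
  also have "(\<Sum>x\<in>torus d N. nbr_avg d ?b x - 1) = (\<Sum>x\<in>torus d N. ?b x - 1)"
    using sum_torus_nbr_avg[of N ?b d] periodic_path_op[OF _ per, of "\<lambda>_. 1" d c "replicate k True"] assms
    by (simp add: sum_subtractf periodic_def)
  also have "(\<Sum>x\<in>torus d N. ?b x - 1) \<le> real k * real (card A) * M"
    using Suc by simp
  finally show ?case by (simp add: algebra_simps)
qed simp

subsection \<open>Heat kernel bound\<close>

lemma sin_ge_linear:
  fixes x :: real
  assumes "0 \<le> x" "x \<le> pi / 2"
  shows "sin x \<ge> 2 / pi * x"
proof -
  have "concave_on {0..pi/2} (sin :: real \<Rightarrow> real)"
    by (rule f''_le0_imp_concave[where f' = cos and f'' = "\<lambda>x. - sin x"])
       (auto intro!: derivative_eq_intros sin_ge_zero)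
  then have "(1 - 2 / pi * x) * sin 0 + 2 / pi * x * sin (pi / 2)
      \<le> sin ((1 - 2 / pi * x) *\<^sub>R 0 + (2 / pi * x) *\<^sub>R (pi / 2))"
    by (rule concave_onD) (use assms in \<open>auto simp: field_simps\<close>)
  then show ?thesis by simp
qed

text \<open>Orthogonality of the characters of Z/NZ, by real parts. Cosines suffice because the walk
  is symmetric, and the whole Fourier argument stays real.\<close>

lemma sum_cos_roots:
  fixes z :: int and N :: nat
  assumes "N > 0"
  shows "(\<Sum>k<N. cos (2 * pi * real k * of_int z / real N)) = (if int N dvd z then real N else 0)"
proof -
  define w where "w = cis (2 * pi * of_int z / real N)"
  have pow: "w ^ k = cis (2 * pi * real k * of_int z / real N)" for k
  proof -
    have "real k * (2 * pi * of_int z / real N) = 2 * pi * real k * of_int z / real N"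
      by simp
    then show ?thesis by (simp only: w_def Complex.DeMoivre)
  qed
  have "Re (\<Sum>k<N. w ^ k) = (\<Sum>k<N. cos (2 * pi * real k * of_int z / real N))"
    by (simp add: pow)
  moreover have "(\<Sum>k<N. w ^ k) = (if int N dvd z then of_nat N else 0)"
  proof (cases "int N dvd z")
    case True
    then obtain q where "z = int N * q" by auto
    then have "w = cis (2 * pi * of_int q)"
      using assms by (simp add: w_def field_simps)
    also have "\<dots> = 1" by (rule cis_multiple_2pi) simp
    finally show ?thesis using True by simp
  next
    case False
    have "w \<noteq> 1"
    proof
      assume "w = 1"
      then have "cos (2 * pi * of_int z / real N) = 1"
        by (metis w_def cis.sel(1) one_complex.sel(1))
      then obtain q :: int where "2 * pi * of_int z / real N = of_int q * 2 * pi"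
        using cos_one_2pi_int by blast
      then have "(of_int z :: real) = of_int (q * int N)"
        using assms by (simp add: field_simps)
      then have "z = q * int N" using of_int_eq_iff by blast
      then show False using False by simp
    qed
    moreover have "w ^ N = 1"
      unfolding pow using assms cis_multiple_2pi[of "of_int z"] by (simp add: mult.assoc)
    ultimately show ?thesis using False
      by (simp add: sum_gp_strict)
  qed
  ultimately show ?thesis by (metis (mono_tags) Re_complex_of_real of_real_of_nat_eq zero_complex.sel(1))
qed

lemma sum_gaussian_le:
  fixes a :: real
  assumes "a > 0"
  shows "(\<Sum>k\<le>n. exp (- a * (real k)\<^sup>2)) \<le> 1 + 2 / sqrt a"
proof -
  \<comment> \<open>Since exp(-y^2) \<le> 1/(1 + y^2), each term is at most an increment of arctan,
    and the sum telescopes. The crude bound pi/2 < 2 then gives the constant.\<close>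
  have "(\<Sum>k\<le>n. exp (- a * (real k)\<^sup>2)) \<le> 1 + arctan (sqrt a * real n) / sqrt a"
  proof (induction n)
    case (Suc n)
    define x y where "x = sqrt a * real n" and "y = sqrt a * real (Suc n)"
    have "x < y" "x \<ge> 0" using assms by (auto simp: x_def y_def)
    then obtain z where z: "x < z" "z < y" "arctan y - arctan x = (y - x) * inverse (1 + z\<^sup>2)"
      using MVT2[of x y arctan "\<lambda>z. inverse (1 + z\<^sup>2)"] DERIV_arctan by blast
    have yx: "y - x = sqrt a" by (simp add: x_def y_def algebra_simps)
    have y2: "y\<^sup>2 = a * (real (Suc n))\<^sup>2"
      using assms by (simp add: y_def power_mult_distrib)
    have "exp (- (y\<^sup>2)) = inverse (exp (y\<^sup>2))" by (simp add: exp_minus)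
    also have "\<dots> \<le> inverse (1 + y\<^sup>2)"
      by (intro le_imp_inverse_le exp_ge_add_one_self) (simp add: add_pos_nonneg)
    also have "\<dots> \<le> inverse (1 + z\<^sup>2)"
      using z \<open>x \<ge> 0\<close> by (intro le_imp_inverse_le add_left_mono power_mono) (auto simp: add_pos_nonneg)
    also have "\<dots> = (arctan y - arctan x) / sqrt a"
      using z(3) yx assms by simp
    finally have "exp (- a * (real (Suc n))\<^sup>2) \<le> arctan y / sqrt a - arctan x / sqrt a"
      using y2 by (simp add: diff_divide_distrib)
    then show ?case using Suc by (simp add: x_def y_def)
  qed simp
  also have "\<dots> \<le> 1 + 2 / sqrt a"
    using arctan_ubound[of "sqrt a * real n"] pi_less_4 assms
    by (intro add_left_mono divide_right_mono) auto
  finally show ?thesis .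
qed

text \<open>Frequencies on either side of the symmetry point have the same distance to the relevant
  end of the spectrum, so each Gaussian term occurs at most twice.\<close>

lemma sum_gaussian_two_to_one:
  fixes \<kappa> :: "nat \<Rightarrow> nat"
  assumes "a > 0" "{..<N} = S \<union> T" "inj_on \<kappa> S" "inj_on \<kappa> T" "\<And>k. k < N \<Longrightarrow> \<kappa> k \<le> N"
  shows "(\<Sum>k<N. exp (- a * (real (\<kappa> k))\<^sup>2)) \<le> 2 * (1 + 2 / sqrt a)"
proof -
  let ?f = "\<lambda>k. exp (- a * (real k)\<^sup>2)"
  have fin: "finite S" "finite T" using assms(2) by (metis finite_Un finite_lessThan)+
  have half: "(\<Sum>k\<in>U. ?f (\<kappa> k)) \<le> 1 + 2 / sqrt a" if "inj_on \<kappa> U" "U \<subseteq> {..<N}" for U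
  proof -
    have "(\<Sum>k\<in>U. ?f (\<kappa> k)) = (\<Sum>k\<in>\<kappa> ` U. ?f k)"
      using that by (simp add: sum.reindex)
    also have "\<dots> \<le> (\<Sum>k\<le>N. ?f k)"
      using that assms(5) by (intro sum_mono2) auto
    also have "\<dots> \<le> 1 + 2 / sqrt a" by (rule sum_gaussian_le) fact
    finally show ?thesis .
  qed
  have "(\<Sum>k<N. ?f (\<kappa> k)) \<le> (\<Sum>k\<in>S. ?f (\<kappa> k)) + (\<Sum>k\<in>T. ?f (\<kappa> k))"
    unfolding assms(2) by (subst sum_Un) (auto simp: fin intro!: sum_nonneg)
  also have "\<dots> \<le> 2 * (1 + 2 / sqrt a)"
    using half[of S] half[of T] assms by auto
  finally show ?thesis .
qed

section \<open>Quadratic bounds at both ends of the spectrum\<close>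

lemma one_minus_cos_eq: "1 - cos (x :: real) = 2 * (sin (x / 2))\<^sup>2"
  using cos_double_sin[of "x / 2"] by simp

lemma one_plus_cos_eq: "1 + cos (x :: real) = 2 * (cos (x / 2))\<^sup>2"
  using cos_double_cos[of "x / 2"] by simp

lemma one_minus_cos_ge:
  fixes k N :: nat
  assumes "k < N"
  shows "1 - cos (2 * pi * real k / real N) \<ge> 8 * (real (min k (N - k)))\<^sup>2 / (real N)\<^sup>2"
proof -
  define m where "m = min k (N - k)"
  have "sin (pi * real k / real N) = sin (pi * real m / real N)"
  proof (cases "k \<le> N - k")
    case False
    then have "pi * real m / real N = pi - pi * real k / real N"
      using assms by (simp add: m_def of_nat_diff field_simps)
    then show ?thesis by (metis sin_pi_minus)
  qed (simp add: m_def)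
  moreover have "sin (pi * real m / real N) \<ge> 2 / pi * (pi * real m / real N)"
    by (rule sin_ge_linear) (use assms in \<open>auto simp: m_def field_simps\<close>)
  ultimately have "sin (pi * real k / real N) \<ge> 2 * real m / real N" by simp
  then have "(2 * real m / real N)\<^sup>2 \<le> (sin (pi * real k / real N))\<^sup>2"
    by (intro power_mono) auto
  then show ?thesis
    unfolding one_minus_cos_eq m_def by (simp add: power_divide power_mult_distrib)
qed

text \<open>The integer on the right is twice the distance from k to N/2, doubled so that it remains
  a natural number when N is odd.\<close>

lemma one_plus_cos_ge:
  fixes k N :: nat
  assumes "k < N"
  shows "1 + cos (2 * pi * real k / real N)
    \<ge> 2 * (real (if 2 * k \<le> N then N - 2 * k else 2 * k - N))\<^sup>2 / (real N)\<^sup>2"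
proof -
  define m where "m = (if 2 * k \<le> N then N - 2 * k else 2 * k - N)"
  have "\<bar>cos (pi * real k / real N)\<bar> = \<bar>sin (pi * real m / (2 * real N))\<bar>"
  proof (cases "2 * k \<le> N")
    case True
    then have "pi * real m / (2 * real N) = pi / 2 - pi * real k / real N"
      using assms by (simp add: m_def of_nat_diff field_simps)
    then show ?thesis by (simp add: cos_sin_eq)
  next
    case False
    then have "pi * real m / (2 * real N) = - (pi / 2 - pi * real k / real N)"
      using assms by (simp add: m_def of_nat_diff field_simps)
    then show ?thesis by (simp only: sin_minus abs_minus_cancel) (simp add: cos_sin_eq)
  qed
  moreover have "sin (pi * real m / (2 * real N)) \<ge> 2 / pi * (pi * real m / (2 * real N))"
    by (rule sin_ge_linear) (use assms in \<open>auto simp: m_def field_simps\<close>)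
  ultimately have "\<bar>cos (pi * real k / real N)\<bar> \<ge> real m / real N" by simp
  then have "(real m / real N)\<^sup>2 \<le> \<bar>cos (pi * real k / real N)\<bar>\<^sup>2"
    by (intro power_mono) auto
  then show ?thesis
    unfolding one_plus_cos_eq m_def[symmetric] by (simp add: power_divide)
qed

lemma avg_exp_cos_le:
  fixes s \<sigma> :: real
  assumes "s > 0" "N > 0" "\<sigma> = 1 \<or> \<sigma> = -1"
  shows "(\<Sum>k<N. exp (- s * (1 - \<sigma> * cos (2 * pi * real k / real N)))) / real N
    \<le> 2 / real N + 3 / sqrt s"
proof -
  \<comment> \<open>One Gaussian rate for both signs: doubling the distance to 0 in the case
    \<sigma> = 1 turns the constant 8 into 2, the constant of the other case.\<close>
  define a where "a = 2 * s / (real N)\<^sup>2"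
  have a: "a > 0" using assms by (simp add: a_def)
  have sa: "sqrt a = sqrt 2 * sqrt s / real N"
    using assms by (simp add: a_def real_sqrt_divide real_sqrt_mult)
  have "(\<Sum>k<N. exp (- s * (1 - \<sigma> * cos (2 * pi * real k / real N)))) \<le> 2 * (1 + 2 / sqrt a)"
    using assms(3)
  proof
    assume \<sigma>: "\<sigma> = 1"
    define \<kappa> where "\<kappa> k = 2 * min k (N - k)" for k
    have "exp (- s * (1 - \<sigma> * cos (2 * pi * real k / real N))) \<le> exp (- a * (real (\<kappa> k))\<^sup>2)"
      if "k < N" for k
    proof -
      have "s * (8 * (real (min k (N - k)))\<^sup>2 / (real N)\<^sup>2) \<le> s * (1 - cos (2 * pi * real k / real N))"
        using one_minus_cos_ge[OF that] assms by (intro mult_left_mono) auto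
      moreover have "a * (real (\<kappa> k))\<^sup>2 = s * (8 * (real (min k (N - k)))\<^sup>2 / (real N)\<^sup>2)"
        unfolding a_def \<kappa>_def by (simp add: power_mult_distrib)
      ultimately show ?thesis by (simp add: \<sigma>)
    qed
    then have "(\<Sum>k<N. exp (- s * (1 - \<sigma> * cos (2 * pi * real k / real N))))
        \<le> (\<Sum>k<N. exp (- a * (real (\<kappa> k))\<^sup>2))"
      by (intro sum_mono) auto
    also have "\<dots> \<le> 2 * (1 + 2 / sqrt a)"
      by (rule sum_gaussian_two_to_one[where S = "{k. k < N \<and> 2 * k \<le> N}" and T = "{k. k < N \<and> 2 * k > N}"])
        (use a in \<open>auto simp: \<kappa>_def inj_on_def\<close>)
    finally show ?thesis .
  next
    assume \<sigma>: "\<sigma> = -1"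
    define \<kappa> where "\<kappa> k = (if 2 * k \<le> N then N - 2 * k else 2 * k - N)" for k
    have "exp (- s * (1 - \<sigma> * cos (2 * pi * real k / real N))) \<le> exp (- a * (real (\<kappa> k))\<^sup>2)"
      if "k < N" for k
    proof -
      have "s * (2 * (real (\<kappa> k))\<^sup>2 / (real N)\<^sup>2) \<le> s * (1 + cos (2 * pi * real k / real N))"
        using one_plus_cos_ge[OF that] assms unfolding \<kappa>_def by (intro mult_left_mono) auto
      moreover have "a * (real (\<kappa> k))\<^sup>2 = s * (2 * (real (\<kappa> k))\<^sup>2 / (real N)\<^sup>2)"
        unfolding a_def by simp
      ultimately show ?thesis by (simp add: \<sigma>)
    qed
    then have "(\<Sum>k<N. exp (- s * (1 - \<sigma> * cos (2 * pi * real k / real N))))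
        \<le> (\<Sum>k<N. exp (- a * (real (\<kappa> k))\<^sup>2))"
      by (intro sum_mono) auto
    also have "\<dots> \<le> 2 * (1 + 2 / sqrt a)"
      by (rule sum_gaussian_two_to_one[where S = "{k. k < N \<and> 2 * k \<le> N}" and T = "{k. k < N \<and> 2 * k > N}"])
        (use a in \<open>auto simp: \<kappa>_def inj_on_def\<close>)
    finally show ?thesis .
  qed
  then have "(\<Sum>k<N. exp (- s * (1 - \<sigma> * cos (2 * pi * real k / real N)))) / real N
      \<le> 2 * (1 + 2 / sqrt a) / real N"
    by (intro divide_right_mono) auto
  also have "\<dots> = 2 / real N + 2 * (2 / sqrt 2) / sqrt s"
    using assms by (simp add: sa add_divide_distrib)
  also have "2 * (2 / sqrt 2) / sqrt s \<le> 3 / sqrt s"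
  proof (rule divide_right_mono)
    have "2 * (2 / sqrt 2) = 2 * sqrt (2::real)"
      by (metis real_div_sqrt zero_le_numeral)
    also have "\<dots> \<le> 3"
      using real_le_lsqrt[of "3/2" 2] by (simp add: power2_eq_square)
    finally show "2 * (2 / sqrt 2) \<le> (3::real)" .
  qed (use assms in auto)
  finally show ?thesis by simp
qed

text \<open>Cosine products are eigenfunctions: along a direction in J the sum of the two shifted
  cosines gives 2 cos(\<theta>), and a direction outside J leaves the product fixed.\<close>

lemma nbr_avg_prod_cos:
  fixes \<theta> z :: "nat \<Rightarrow> real"
  assumes "J \<subseteq> {..<d}"
  shows "nbr_avg d (\<lambda>x. \<Prod>j\<in>J. cos (\<theta> j * (of_int (x j) - z j))) x =
    ((real d - real (card J) + (\<Sum>j\<in>J. cos (\<theta> j))) / real d) * (\<Prod>j\<in>J. cos (\<theta> j * (of_int (x j) - z j)))"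
proof -
  let ?f = "\<lambda>x. \<Prod>j\<in>J. cos (\<theta> j * (of_int (x j) - z j))"
  have fin: "finite J" using assms finite_subset by blast
  have in_J: "?f (nbr_up x i) + ?f (nbr_down x i) = 2 * cos (\<theta> i) * ?f x" if "i \<in> J" for i
  proof -
    let ?R = "\<Prod>j\<in>J - {i}. cos (\<theta> j * (of_int (x j) - z j))"
    have "?f (nbr_up x i) = cos (\<theta> i * (of_int (x i) - z i) + \<theta> i) * ?R"
      unfolding prod.remove[OF fin that]
      by (intro arg_cong2[where f = times] prod.cong) (auto simp: nbr_up_def unit_vec_def algebra_simps)
    moreover have "?f (nbr_down x i) = cos (\<theta> i * (of_int (x i) - z i) - \<theta> i) * ?R"
      unfolding prod.remove[OF fin that]
      by (intro arg_cong2[where f = times] prod.cong) (auto simp: nbr_down_def unit_vec_def algebra_simps)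
    ultimately show ?thesis
      unfolding prod.remove[OF fin that] cos_add cos_diff by (simp add: algebra_simps)
  qed
  have not_in_J: "?f (nbr_up x i) + ?f (nbr_down x i) = 2 * ?f x" if "i \<notin> J" for i
  proof -
    have "?f (nbr_up x i) = ?f x" "?f (nbr_down x i) = ?f x"
      by (rule prod.cong; use that in \<open>auto simp: nbr_up_def nbr_down_def unit_vec_def\<close>)+
    then show ?thesis by simp
  qed
  have "(\<Sum>i<d. ?f (nbr_up x i) + ?f (nbr_down x i))
      = (\<Sum>i\<in>J. 2 * cos (\<theta> i) * ?f x) + (\<Sum>i\<in>{..<d} - J. 2 * ?f x)"
    using sum.subset_diff[OF assms, of "\<lambda>i. ?f (nbr_up x i) + ?f (nbr_down x i)"] in_J not_in_J by simp
  also have "\<dots> = 2 * ((real d - real (card J) + (\<Sum>j\<in>J. cos (\<theta> j))) * ?f x)"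
    using assms fin card_mono[of "{..<d}" J]
    by (simp add: card_Diff_subset of_nat_diff sum_distrib_left sum_distrib_right algebra_simps)
  finally show ?thesis unfolding nbr_avg_def by simp
qed

text \<open>The first product handles a nonnegative eigenvalue, the second a negative one, both
  through 1 - y \<le> exp(-y). They are added instead of distinguished because each of them
  factorises over the coordinates once it is summed over all frequencies.\<close>

lemma abs_eigenvalue_pow_le:
  fixes \<theta> :: "nat \<Rightarrow> real"
  assumes "J \<subseteq> {..<d}" "d > 0"
  shows "\<bar>(real d - real (card J) + (\<Sum>j\<in>J. cos (\<theta> j))) / real d\<bar> ^ t
    \<le> (\<Prod>j\<in>J. exp (- (real t / real d) * (1 - 1 * cos (\<theta> j))))
      + (\<Prod>j\<in>J. exp (- (real t / real d) * (1 - (-1) * cos (\<theta> j))))"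
proof -
  have fin: "finite J" using assms finite_subset by blast
  define \<phi> where "\<phi> = (real d - real (card J) + (\<Sum>j\<in>J. cos (\<theta> j))) / real d"
  have cJ: "real (card J) \<le> real d" using card_mono[OF _ assms(1)] by simp
  have key: "\<bar>\<phi>\<bar> ^ t \<le> (\<Prod>j\<in>J. exp (- (real t / real d) * (1 - \<sigma> * cos (\<theta> j))))"
    if "\<bar>\<phi>\<bar> \<le> 1 - (\<Sum>j\<in>J. 1 - \<sigma> * cos (\<theta> j)) / real d" for \<sigma>
  proof -
    have "\<bar>\<phi>\<bar> \<le> exp (- ((\<Sum>j\<in>J. 1 - \<sigma> * cos (\<theta> j)) / real d))"
      using that exp_ge_add_one_self[of "- ((\<Sum>j\<in>J. 1 - \<sigma> * cos (\<theta> j)) / real d)"] by linarith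
    then have "\<bar>\<phi>\<bar> ^ t \<le> exp (- ((\<Sum>j\<in>J. 1 - \<sigma> * cos (\<theta> j)) / real d)) ^ t"
      by (intro power_mono) auto
    also have "\<dots> = exp (\<Sum>j\<in>J. - (real t / real d) * (1 - \<sigma> * cos (\<theta> j)))"
      by (simp add: exp_of_nat_mult[symmetric] sum_distrib_left sum_divide_distrib sum_negf)
    also have "\<dots> = (\<Prod>j\<in>J. exp (- (real t / real d) * (1 - \<sigma> * cos (\<theta> j))))"
      by (rule exp_sum[OF fin])
    finally show ?thesis .
  qed
  have pos: "(\<Prod>j\<in>J. exp (- (real t / real d) * (1 - \<sigma> * cos (\<theta> j)))) \<ge> 0" for \<sigma>
    by (intro prod_nonneg) auto
  show ?thesis
  proof (cases "\<phi> \<ge> 0")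
    case True
    have "\<bar>\<phi>\<bar> \<le> 1 - (\<Sum>j\<in>J. 1 - 1 * cos (\<theta> j)) / real d"
      using True assms by (simp add: \<phi>_def sum_subtractf field_simps)
    from key[OF this] pos[of "-1"] show ?thesis by (simp add: \<phi>_def)
  next
    case False
    then have "\<bar>\<phi>\<bar> \<le> 1 - (\<Sum>j\<in>J. 1 - (-1) * cos (\<theta> j)) / real d"
      using cJ assms by (simp add: \<phi>_def sum.distrib field_simps)
    from key[OF this] pos[of "1"] show ?thesis by (simp add: \<phi>_def)
  qed
qed

text \<open>The indicator is expanded in cosine products, which the walk multiplies by powers of
  eigenvalues; bounding the cosines by 1 makes the estimate uniform in \<open>x\<close>, and what is
  left is a product of one-dimensional averages. The choice of J gives the full kernel (all
  coordinates) or the transversal one.\<close>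

lemma heat_kernel_bound:
  fixes x a :: "nat \<Rightarrow> int"
  assumes J: "J \<subseteq> {..<d}" and "N > 0" "d > 0" "t > 0"
  shows "(nbr_avg d ^^ t) (indicator {y. \<forall>j\<in>J. int N dvd y j - a j}) x
    \<le> 2 * (2 / real N + 3 * sqrt (real d) / sqrt (real t)) ^ card J"
proof -
  have fin: "finite J" using assms finite_subset by blast
  define K where "K = (J \<rightarrow>\<^sub>E {..<N})"
  define \<theta> where "\<theta> k j = 2 * pi * real (k j) / real N" for k :: "nat \<Rightarrow> nat" and j :: nat
  define e where "e k y = (\<Prod>j\<in>J. cos (\<theta> k j * (of_int (y j) - of_int (a j))))"
    for k and y :: "nat \<Rightarrow> int"
  define \<phi> where "\<phi> k = (real d - real (card J) + (\<Sum>j\<in>J. cos (\<theta> k j))) / real d" for k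
  have ind: "indicator {y. \<forall>j\<in>J. int N dvd y j - a j} = (\<lambda>y. (1 / real N) ^ card J * (\<Sum>k\<in>K. e k y))"
  proof
    fix y :: "nat \<Rightarrow> int"
    have one: "(1 / real N) * (\<Sum>k<N. cos (2 * pi * real k / real N * (of_int (y j) - of_int (a j))))
        = (if int N dvd y j - a j then 1 else 0)" for j
      using sum_cos_roots[of N "y j - a j"] assms(2) by simp
    have "(\<Sum>k\<in>K. e k y) = (\<Prod>j\<in>J. \<Sum>k<N. cos (2 * pi * real k / real N * (of_int (y j) - of_int (a j))))"
      unfolding K_def e_def \<theta>_def by (rule prod_sum_PiE[symmetric]) (auto simp: fin)
    then have "(1 / real N) ^ card J * (\<Sum>k\<in>K. e k y)
        = (\<Prod>j\<in>J. (1 / real N) * (\<Sum>k<N. cos (2 * pi * real k / real N * (of_int (y j) - of_int (a j)))))"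
      by (simp only: prod.distrib prod_constant)
    also have "\<dots> = indicator {y. \<forall>j\<in>J. int N dvd y j - a j} y"
      unfolding one using fin by (auto simp: indicator_def)
    finally show "indicator {y. \<forall>j\<in>J. int N dvd y j - a j} y = (1 / real N) ^ card J * (\<Sum>k\<in>K. e k y)" ..
  qed
  have eigen: "(nbr_avg d ^^ t) (e k) = (\<lambda>y. \<phi> k ^ t * e k y)" for t k
  proof (induction t)
    case (Suc t)
    have "nbr_avg d (e k) y = \<phi> k * e k y" for y
      unfolding e_def \<phi>_def by (rule nbr_avg_prod_cos[OF J])
    then show ?case by (simp add: Suc nbr_avg_cmult fun_eq_iff)
  qed simp
  have e1: "\<bar>e k y\<bar> \<le> 1" for k y
    unfolding e_def abs_prod by (rule prod_le_1) auto
  define E where "E \<sigma> j k = exp (- (real t / real d) * (1 - \<sigma> * cos (2 * pi * real k / real N)))"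
    for \<sigma> and j k :: nat
  define B where "B = 2 / real N + 3 * sqrt (real d) / sqrt (real t)"
  have sumE: "(1 / real N) ^ card J * (\<Sum>k\<in>K. \<Prod>j\<in>J. E \<sigma> j (k j)) \<le> B ^ card J"
    if "\<sigma> = 1 \<or> \<sigma> = -1" for \<sigma>
  proof -
    have "(\<Sum>k\<in>K. \<Prod>j\<in>J. E \<sigma> j (k j)) = (\<Prod>j\<in>J. \<Sum>k<N. E \<sigma> j k)"
      unfolding K_def by (rule prod_sum_PiE[symmetric]) (auto simp: fin)
    then have "(1 / real N) ^ card J * (\<Sum>k\<in>K. \<Prod>j\<in>J. E \<sigma> j (k j)) = (\<Prod>j\<in>J. (\<Sum>k<N. E \<sigma> j k) / real N)"
      by (simp add: prod_dividef power_divide)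
    also have "\<dots> \<le> (\<Prod>j\<in>J. B)"
    proof (intro prod_mono conjI)
      fix j
      show "(\<Sum>k<N. E \<sigma> j k) / real N \<ge> 0"
        by (intro divide_nonneg_nonneg sum_nonneg) (auto simp: E_def)
      have "(\<Sum>k<N. E \<sigma> j k) / real N \<le> 2 / real N + 3 / sqrt (real t / real d)"
        unfolding E_def by (rule avg_exp_cos_le) (use assms that in auto)
      also have "\<dots> = B" by (simp add: B_def real_sqrt_divide)
      finally show "(\<Sum>k<N. E \<sigma> j k) / real N \<le> B" .
    qed
    finally show ?thesis by simp
  qed
  have "(nbr_avg d ^^ t) (indicator {y. \<forall>j\<in>J. int N dvd y j - a j}) x
      = (1 / real N) ^ card J * (\<Sum>k\<in>K. \<phi> k ^ t * e k x)"
    unfolding ind nbr_avg_pow_cmult nbr_avg_pow_sum eigen ..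
  also have "\<dots> \<le> (1 / real N) ^ card J * (\<Sum>k\<in>K. (\<Prod>j\<in>J. E 1 j (k j)) + (\<Prod>j\<in>J. E (-1) j (k j)))"
  proof (intro mult_left_mono sum_mono)
    fix k
    have "\<phi> k ^ t * e k x \<le> \<bar>\<phi> k ^ t * e k x\<bar>" by simp
    also have "\<dots> \<le> \<bar>\<phi> k\<bar> ^ t * 1"
      unfolding abs_mult power_abs by (intro mult_left_mono e1) auto
    also have "\<dots> \<le> (\<Prod>j\<in>J. E 1 j (k j)) + (\<Prod>j\<in>J. E (-1) j (k j))"
      unfolding E_def \<phi>_def \<theta>_def mult_1_right by (rule abs_eigenvalue_pow_le[OF J \<open>d > 0\<close>])
    finally show "\<phi> k ^ t * e k x \<le> (\<Prod>j\<in>J. E 1 j (k j)) + (\<Prod>j\<in>J. E (-1) j (k j))" .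
  qed simp
  also have "\<dots> \<le> 2 * B ^ card J"
    using sumE[of 1] sumE[of "-1"] by (simp add: sum.distrib distrib_left)
  finally show ?thesis unfolding B_def .
qed

subsection \<open>First step analysis for the law of the steps\<close>

lemma sequence_space_steps: "sequence_space (measure_pmf (step_pmf d))"
  by unfold_locales

lemma prob_space_steps_law: "prob_space (steps_law d)"
  unfolding steps_law_def by (intro prob_space_PiM measure_pmf.prob_space_axioms)

lemma space_steps_law [simp]: "space (steps_law d) = UNIV"
  by (simp add: steps_law_def space_PiM)

lemma measurable_displacement [measurable]:
  "(\<lambda>\<xi>. displacement \<xi> n i) \<in> measurable (steps_law d) (count_space UNIV)"
proof (induction n)
  case (Suc n)
  have [measurable]: "(\<lambda>\<xi>. \<xi> n) \<in> measurable (steps_law d) (measure_pmf (step_pmf d))"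
    unfolding steps_law_def by (rule measurable_component_singleton) simp
  have "(\<lambda>s. a + s i) \<in> measurable (measure_pmf (step_pmf d)) (count_space UNIV)" for a :: int
    by simp
  then have [measurable]: "(\<lambda>\<xi>. a + \<xi> n i) \<in> measurable (steps_law d) (count_space UNIV)" for a :: int
    by (rule measurable_compose[rotated]) measurable
  have "(\<lambda>\<xi>. displacement \<xi> n i + \<xi> n i) \<in> measurable (steps_law d) (count_space UNIV)"
    by (rule measurable_compose_countable[OF _ Suc]) measurable
  then show ?case by (simp add: displacement_def)
qed (simp add: displacement_def)

lemma displacement_case_nat:
  "displacement (case_nat s \<xi>) (Suc n) i = s i + displacement \<xi> n i"
  unfolding displacement_def by (subst sum.lessThan_Suc_shift) simp

text \<open>The 2 d steps are pairwise distinct vectors of Z^d, which is what turns the uniform law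
  on the set of steps into \<open>nbr_avg\<close>.\<close>

lemma sum_steps:
  fixes g :: "(nat \<Rightarrow> int) \<Rightarrow> 'a :: comm_monoid_add"
  shows "sum g (\<Union>i<d. {unit_vec i, (\<lambda>j. - unit_vec i j)})
    = (\<Sum>i<d. g (unit_vec i) + g (\<lambda>j. - unit_vec i j))"
proof -
  have neq: "unit_vec i \<noteq> (\<lambda>j. - unit_vec i' j)" for i i'
    by (auto simp: unit_vec_def fun_eq_iff intro!: exI[of _ i])
  have inj: "unit_vec i = unit_vec i' \<longleftrightarrow> i = i'" for i i'
    by (auto simp: unit_vec_def fun_eq_iff split: if_splits)
  have inj': "(\<lambda>j. - unit_vec i j) = (\<lambda>j. - unit_vec i' j) \<longleftrightarrow> i = i'" for i i'
    using inj by (auto simp: fun_eq_iff)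
  have "sum g (\<Union>i<d. {unit_vec i, (\<lambda>j. - unit_vec i j)})
      = (\<Sum>i<d. sum g {unit_vec i, (\<lambda>j. - unit_vec i j)})"
    by (rule sum.UNION_disjoint) (auto simp: inj inj' neq neq[symmetric])
  then show ?thesis by (simp add: neq)
qed

lemma integral_step_pmf:
  fixes g :: "(nat \<Rightarrow> int) \<Rightarrow> real"
  assumes "d > 0"
  shows "(\<integral>s. g s \<partial>measure_pmf (step_pmf d))
    = (\<Sum>i<d. g (unit_vec i) + g (\<lambda>j. - unit_vec i j)) / (2 * real d)"
proof -
  let ?U = "\<Union>i<d. {unit_vec i, (\<lambda>j. - unit_vec i j)}"
  have "real (card ?U) = 2 * real d"
    using sum_steps[of "\<lambda>_. 1::real" d] by simp
  moreover have "?U \<noteq> {}" using assms by auto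
  ultimately show ?thesis
    unfolding step_pmf_def by (subst integral_pmf_of_set) (auto simp: sum_steps)
qed

text \<open>An i.i.d. sequence has the law of an independent first term put in front of another such
  sequence. The bound B supplies the integrability for Fubini.\<close>

lemma integral_steps_law_first_step:
  fixes f :: "(nat \<Rightarrow> nat \<Rightarrow> int) \<Rightarrow> real"
  assumes "d > 0" and [measurable]: "f \<in> borel_measurable (steps_law d)" and bd: "\<And>\<xi>. \<bar>f \<xi>\<bar> \<le> B"
  shows "(\<integral>\<xi>. f \<xi> \<partial>steps_law d) =
    (\<Sum>i<d. (\<integral>\<xi>. f (case_nat (unit_vec i) \<xi>) \<partial>steps_law d)
      + (\<integral>\<xi>. f (case_nat (\<lambda>j. - unit_vec i j) \<xi>) \<partial>steps_law d)) / (2 * real d)"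
proof -
  let ?M = "measure_pmf (step_pmf d)" and ?S = "steps_law d"
  interpret sequence_space ?M by (rule sequence_space_steps)
  interpret S: prob_space ?S by (rule prob_space_steps_law)
  interpret P: pair_prob_space ?M ?S by unfold_locales
  have S: "S = ?S" unfolding steps_law_def ..
  have [measurable]: "(\<lambda>(s, \<xi>). case_nat s \<xi>) \<in> measurable (?M \<Otimes>\<^sub>M ?S) ?S"
    unfolding S[symmetric] by measurable
  have "(\<integral>\<xi>. f \<xi> \<partial>?S) = (\<integral>\<xi>. f \<xi> \<partial>distr (?M \<Otimes>\<^sub>M ?S) ?S (\<lambda>(s, \<xi>). case_nat s \<xi>))"
    using PiM_iter unfolding S by simp
  also have "\<dots> = (\<integral>p. f (case_nat (fst p) (snd p)) \<partial>(?M \<Otimes>\<^sub>M ?S))"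
    by (subst integral_distr) (auto simp: case_prod_beta)
  also have "\<dots> = (\<integral>s. (\<integral>\<xi>. f (case_nat s \<xi>) \<partial>?S) \<partial>?M)"
  proof (subst P.integral_fst'[symmetric])
    have [measurable]: "(\<lambda>p. f (case_nat (fst p) (snd p))) \<in> borel_measurable (?M \<Otimes>\<^sub>M ?S)"
      using measurable_compose[OF \<open>(\<lambda>(s, \<xi>). case_nat s \<xi>) \<in> measurable (?M \<Otimes>\<^sub>M ?S) ?S\<close> assms(2)]
      by (simp add: case_prod_beta)
    show "integrable (?M \<Otimes>\<^sub>M ?S) (\<lambda>p. f (case_nat (fst p) (snd p)))"
      by (rule P.integrable_const_bound[of _ B]) (auto simp: bd)
  qed simp
  also have "\<dots> = (\<Sum>i<d. (\<integral>\<xi>. f (case_nat (unit_vec i) \<xi>) \<partial>?S)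
      + (\<integral>\<xi>. f (case_nat (\<lambda>j. - unit_vec i j) \<xi>) \<partial>?S)) / (2 * real d)"
    by (rule integral_step_pmf) fact
  finally show ?thesis .
qed

lemma nbr_eq:
  "(\<lambda>j. x j + (unit_vec i j + z j)) = (\<lambda>j. nbr_up x i j + z j)"
  "(\<lambda>j. x j + (z j - unit_vec i j)) = (\<lambda>j. nbr_down x i j + z j)"
  by (auto simp: nbr_up_def nbr_down_def)

text \<open>The link from probability to operators: all later estimates on visit weights are made
  for \<open>path_op\<close> and read back through this identity.\<close>

lemma integral_path_weight:
  assumes "d > 0" "c \<ge> 1"
    and [measurable]: "\<And>x n. Measurable.pred (steps_law d) (\<lambda>\<xi>. (\<lambda>i. x i + displacement \<xi> n i) \<in> S)"
  shows "(\<integral>\<xi>. (\<Prod>n<length bs. if bs ! n \<and> (\<lambda>i. x i + displacement \<xi> n i) \<in> S then c else 1)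
      \<partial>steps_law d) = path_op d c S bs (\<lambda>_. 1) x"
proof (induction bs arbitrary: x)
  case Nil
  interpret prob_space "steps_law d" by (rule prob_space_steps_law)
  show ?case using prob_space by simp
next
  case (Cons b bs)
  let ?w = "\<lambda>x n \<xi>. if bs ! n \<and> (\<lambda>i. x i + displacement \<xi> n i) \<in> S then c else 1"
  let ?w' = "\<lambda>n \<xi>. if bs ! n \<and> (\<lambda>i. x i + displacement \<xi> (Suc n) i) \<in> S then c else 1"
  have bd: "\<bar>\<Prod>n<length bs. ?w' n \<xi>\<bar> \<le> c ^ length bs" for \<xi>
  proof -
    have "\<bar>\<Prod>n<length bs. ?w' n \<xi>\<bar> = (\<Prod>n<length bs. \<bar>?w' n \<xi>\<bar>)"
      by (rule abs_prod)
    also have "\<dots> \<le> (\<Prod>n<length bs. c)"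
      by (rule prod_mono) (use assms in auto)
    finally show ?thesis by simp
  qed
  have "(\<integral>\<xi>. (\<Prod>n<length (b # bs). if (b # bs) ! n \<and> (\<lambda>i. x i + displacement \<xi> n i) \<in> S then c else 1)
      \<partial>steps_law d)
    = (if b \<and> x \<in> S then c else 1) * (\<integral>\<xi>. (\<Prod>n<length bs. ?w' n \<xi>) \<partial>steps_law d)"
    by (simp only: length_Cons prod.lessThan_Suc_shift integral_mult_right_zero nth_Cons_0 nth_Cons_Suc)
      (simp add: displacement_def)
  also have "(\<integral>\<xi>. (\<Prod>n<length bs. ?w' n \<xi>) \<partial>steps_law d)
     = nbr_avg d (\<lambda>y. \<integral>\<xi>. (\<Prod>n<length bs. ?w y n \<xi>) \<partial>steps_law d) x"
    unfolding nbr_avg_def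
    by (subst integral_steps_law_first_step[OF assms(1) _ bd])
       (auto simp: displacement_case_nat nbr_eq)
  finally show ?case by (simp add: Cons path_op_Cons)
qed

lemma prob_hit_after_first_step:
  assumes "d > 0"
    and [measurable]: "\<And>x n. Measurable.pred (steps_law d) (\<lambda>\<xi>. (\<lambda>i. x i + displacement \<xi> n i) \<in> S)"
  shows "\<P>(\<xi> in steps_law d. \<exists>n<k. (\<lambda>i. x i + displacement \<xi> (Suc n) i) \<in> S)
    = nbr_avg d (\<lambda>y. \<P>(\<xi> in steps_law d. \<exists>n<k. (\<lambda>i. y i + displacement \<xi> n i) \<in> S)) x"
proof -
  interpret prob_space "steps_law d" by (rule prob_space_steps_law)
  define E where "E = {\<xi>. \<exists>n<k. (\<lambda>i. x i + displacement \<xi> (Suc n) i) \<in> S}"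
  define E' where "E' y = {\<xi>. \<exists>n<k. (\<lambda>i. y i + displacement \<xi> n i) \<in> S}" for y
  have "Measurable.pred (steps_law d) (\<lambda>\<xi>. \<exists>n<k. (\<lambda>i. x i + displacement \<xi> (Suc n) i) \<in> S)"
    by measurable
  then have E [measurable]: "E \<in> sets (steps_law d)" by (simp add: E_def pred_def)
  have "Measurable.pred (steps_law d) (\<lambda>\<xi>. \<exists>n<k. (\<lambda>i. y i + displacement \<xi> n i) \<in> S)" for y
    by measurable
  then have E' [measurable]: "E' y \<in> sets (steps_law d)" for y by (simp add: E'_def pred_def)
  have ind: "indicator E (case_nat (unit_vec i) \<xi>) = (indicator (E' (nbr_up x i)) \<xi> :: real)"
    "indicator E (case_nat (\<lambda>j. - unit_vec i j) \<xi>) = (indicator (E' (nbr_down x i)) \<xi> :: real)" for i \<xi>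
    by (auto simp: E_def E'_def displacement_case_nat nbr_eq indicator_def)
  have bd: "\<bar>indicator E \<xi> :: real\<bar> \<le> 1" for \<xi>
    by (auto simp: indicator_def)
  have "measure (steps_law d) E = (\<integral>\<xi>. indicator E \<xi> \<partial>steps_law d)" by simp
  also have "\<dots> = nbr_avg d (\<lambda>y. measure (steps_law d) (E' y)) x"
    by (subst integral_steps_law_first_step[OF assms(1) _ bd]) (auto simp: ind nbr_avg_def)
  finally show ?thesis by (simp add: E_def E'_def)
qed

lemma prob_hit:
  assumes "d > 0"
    and meas: "\<And>x n. Measurable.pred (steps_law d) (\<lambda>\<xi>. (\<lambda>i. x i + displacement \<xi> n i) \<in> S)"
  shows "\<P>(\<xi> in steps_law d. \<exists>n<k. (\<lambda>i. x i + displacement \<xi> n i) \<in> S) = hit d S k x"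
proof (induction k arbitrary: x)
  case (Suc k)
  interpret prob_space "steps_law d" by (rule prob_space_steps_law)
  have "(\<exists>n<Suc k. (\<lambda>i. x i + displacement \<xi> n i) \<in> S)
      \<longleftrightarrow> x \<in> S \<or> (\<exists>n<k. (\<lambda>i. x i + displacement \<xi> (Suc n) i) \<in> S)" for \<xi>
    unfolding Ex_less_Suc2 by (simp add: displacement_def)
  then show ?case
    using prob_hit_after_first_step[OF assms, of k x] prob_space Suc by simp
qed simp

lemma pred_displacement_zero:
  "Measurable.pred (steps_law d) (\<lambda>\<xi>. (\<lambda>i. x i + displacement \<xi> n i) \<in> {\<lambda>_. 0})"
  unfolding singleton_iff fun_eq_iff by measurable

lemma pred_displacement_torus:
  assumes "finite A"
  shows "Measurable.pred (steps_law d)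
    (\<lambda>\<xi>. (\<lambda>i. x i + displacement \<xi> n i) \<in> {y. torus_proj N y \<in> A})"
proof -
  have "(\<lambda>\<xi>. (\<lambda>i. x i + displacement \<xi> n i) \<in> {y. torus_proj N y \<in> A})
      = (\<lambda>\<xi>. \<exists>a\<in>A. \<forall>i. (x i + displacement \<xi> n i) mod int N = a i)"
    by (auto simp: torus_proj_def fun_eq_iff) 
  then show ?thesis using assms by (simp only:) measurable
qed

text \<open>A return within a finite horizon is a return at some time. Starting \<open>hit\<close>
  after the first step excludes the trivial visit at time 0.\<close>

lemma return_le_return_prob:
  assumes "\<nu> > 0"
  shows "nbr_avg \<nu> (hit \<nu> {\<lambda>_. 0} k) (\<lambda>_. 0) \<le> return_prob \<nu>"
proof -
  interpret prob_space "steps_law \<nu>" by (rule prob_space_steps_law)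
  have "Measurable.pred (steps_law \<nu>) (\<lambda>\<xi>. \<exists>n\<ge>1. \<forall>i. displacement \<xi> n i = 0)"
    by measurable
  then have *: "{\<xi>. \<exists>n\<ge>1. displacement \<xi> n = (\<lambda>_. 0)} \<in> sets (steps_law \<nu>)"
    by (simp add: pred_def fun_eq_iff)
  have "nbr_avg \<nu> (hit \<nu> {\<lambda>_. 0} k) (\<lambda>_. 0)
      = prob {\<xi>. \<exists>n<k. (\<lambda>i. displacement \<xi> (Suc n) i) = (\<lambda>_. 0)}"
    using prob_hit_after_first_step[OF assms pred_displacement_zero, of k "\<lambda>_. 0"]
      prob_hit[OF assms pred_displacement_zero] by (simp add: nbr_avg_def)
  also have "\<dots> \<le> prob {\<xi>. \<exists>n\<ge>1. displacement \<xi> n = (\<lambda>_. 0)}"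
    by (rule finite_measure_mono[OF _ *]) auto
  finally show ?thesis by (simp add: return_prob_def)
qed

subsection \<open>Returns to a coset\<close>

text \<open>The lift to Z^d of a coordinate coset through \<open>a\<close>: J lists the transversal
  directions, which are fixed modulo N, and the remaining ones are free.\<close>

definition same_coset :: "nat \<Rightarrow> nat set \<Rightarrow> (nat \<Rightarrow> int) \<Rightarrow> (nat \<Rightarrow> int) set" where
  "same_coset N J a = {y. \<forall>j\<in>J. int N dvd y j - a j}"

lemma same_coset_eq:
  assumes "x \<in> same_coset N J a"
  shows "same_coset N J x = same_coset N J a"
proof -
  have "int N dvd y j - x j \<longleftrightarrow> int N dvd y j - a j" if "j \<in> J" for y j
  proof -
    have "int N dvd x j - a j" using assms that by (simp add: same_coset_def)
    then have "int N dvd (y j - x j) + (x j - a j) \<longleftrightarrow> int N dvd y j - x j"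
      by (rule dvd_add_left_iff)
    then show ?thesis by simp
  qed
  then show ?thesis by (simp add: same_coset_def)
qed

text \<open>\<sigma> records the transversal coordinates relative to \<open>x\<close>, renumbered by
  \<open>b\<close> so that they form a walk on Z^\<nu>; this walk moves with probability \<nu>/d and
  pauses otherwise.\<close>

lemma nbr_avg_coords:
  fixes h :: "(nat \<Rightarrow> int) \<Rightarrow> real"
  assumes b: "bij_betw b {..<\<nu>} J" and J: "J \<subseteq> {..<d}" and "\<nu> > 0"
    and \<sigma>: "\<sigma> = (\<lambda>y i. if i < \<nu> then y (b i) - x (b i) else 0)"
  shows "nbr_avg d (\<lambda>y. h (\<sigma> y)) y
    = (1 - real \<nu> / real d) * h (\<sigma> y) + real \<nu> / real d * nbr_avg \<nu> h (\<sigma> y)"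
proof -
  have cJ: "card J = \<nu>" using bij_betw_same_card[OF b] by simp
  have "d > 0" "\<nu> \<le> d" using J card_mono[OF _ J] cJ \<open>\<nu> > 0\<close> by auto
  have fin: "finite J" using J finite_subset by blast
  let ?g = "\<lambda>i. h (\<sigma> (nbr_up y i)) + h (\<sigma> (nbr_down y i))"
  have in_J: "?g (b i) = h (nbr_up (\<sigma> y) i) + h (nbr_down (\<sigma> y) i)" if "i < \<nu>" for i
  proof -
    have "b i' = b i \<longleftrightarrow> i' = i" if "i' < \<nu>" for i'
      using b that \<open>i < \<nu>\<close> by (auto simp: bij_betw_def inj_on_def)
    then have "\<sigma> (nbr_up y (b i)) = nbr_up (\<sigma> y) i" "\<sigma> (nbr_down y (b i)) = nbr_down (\<sigma> y) i"
      using that by (auto simp: \<sigma> nbr_up_def nbr_down_def unit_vec_def fun_eq_iff)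
    then show ?thesis by simp
  qed
  have not_in_J: "?g i = 2 * h (\<sigma> y)" if "i \<notin> J" for i
  proof -
    have "b i' \<noteq> i" if "i' < \<nu>" for i'
      using b that \<open>i \<notin> J\<close> by (auto simp: bij_betw_def)
    then have "\<sigma> (nbr_up y i) = \<sigma> y" "\<sigma> (nbr_down y i) = \<sigma> y"
      by (auto simp: \<sigma> nbr_up_def nbr_down_def unit_vec_def fun_eq_iff)
    then show ?thesis by simp
  qed
  have "(\<Sum>i<d. ?g i) = (\<Sum>i\<in>{..<d} - J. ?g i) + (\<Sum>i\<in>J. ?g i)"
    by (rule sum.subset_diff[OF J]) simp
  also have "(\<Sum>i\<in>J. ?g i) = (\<Sum>i<\<nu>. ?g (b i))"
    by (rule sum.reindex_bij_betw[OF b, symmetric])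
  also have "\<dots> = 2 * real \<nu> * nbr_avg \<nu> h (\<sigma> y)"
    using in_J \<open>\<nu> > 0\<close> by (simp add: nbr_avg_def)
  also have "(\<Sum>i\<in>{..<d} - J. ?g i) = 2 * (real d - real \<nu>) * h (\<sigma> y)"
    using not_in_J fin J cJ \<open>\<nu> \<le> d\<close> by (simp add: card_Diff_subset of_nat_diff)
  finally show ?thesis
    using \<open>d > 0\<close> by (simp add: nbr_avg_def[of d] field_simps)
qed

text \<open>For fewer than \<open>N\<close> steps the walk cannot wrap around the torus, so the coordinates
  transversal to the coset perform a lazy walk on \<open>\<int>\<^sup>\<nu>\<close>; dropping its pauses only helps
  hitting the origin within \<open>k\<close> steps.\<close>

lemma hit_coset_le_hit_origin:
  assumes b: "bij_betw b {..<\<nu>} J" and J: "J \<subseteq> {..<d}" and "\<nu> > 0"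
    and \<sigma>: "\<sigma> = (\<lambda>y i. if i < \<nu> then y (b i) - x (b i) else 0)"
    and "\<And>j. j \<in> J \<Longrightarrow> \<bar>y j - x j\<bar> + int k \<le> int N"
  shows "hit d (same_coset N J x) k y \<le> hit \<nu> {\<lambda>_. 0} k (\<sigma> y)"
  using assms(5)
proof (induction k arbitrary: y)
  case (Suc k)
  have "\<nu> \<le> d" using J card_mono[OF _ J] bij_betw_same_card[OF b] by simp
  \<comment> \<open>The distance to \<open>x\<close> plus the remaining time is at most N. With at
    least one position left to inspect, the distance is less than N, so congruence modulo N is
    equality.\<close>
  have *: "y \<in> same_coset N J x \<longleftrightarrow> \<sigma> y = (\<lambda>_. 0)"
  proof
    assume y: "y \<in> same_coset N J x"
    show "\<sigma> y = (\<lambda>_. 0)"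
    proof
      fix i
      show "\<sigma> y i = 0"
      proof (cases "i < \<nu>")
        case True
        then have "b i \<in> J" using b by (auto simp: bij_betw_def)
        then have "int N dvd y (b i) - x (b i)" "\<bar>y (b i) - x (b i)\<bar> < int N"
          using y Suc.prems[of "b i"] by (auto simp: same_coset_def)
        then have "y (b i) - x (b i) = 0"
          using dvd_imp_le_int[of "y (b i) - x (b i)" "int N"] by (cases "y (b i) - x (b i) = 0") auto
        then show ?thesis by (simp add: \<sigma>)
      qed (simp add: \<sigma>)
    qed
  next
    assume "\<sigma> y = (\<lambda>_. 0)"
    then have "y (b i) = x (b i)" if "i < \<nu>" for i
      using that by (auto simp: \<sigma> fun_eq_iff split: if_splits)
    then show "y \<in> same_coset N J x"
      using b by (auto simp: same_coset_def bij_betw_def)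
  qed
  show ?case
  proof (cases "y \<in> same_coset N J x")
    case False
    let ?h = "hit \<nu> {\<lambda>_. 0} k"
    have "nbr_avg d (hit d (same_coset N J x) k) y \<le> nbr_avg d (\<lambda>y. ?h (\<sigma> y)) y"
      unfolding nbr_avg_def
    proof (intro divide_right_mono sum_mono add_mono Suc.IH)
      fix i j assume "j \<in> J"
      from Suc.prems[OF this]
      show "\<bar>nbr_up y i j - x j\<bar> + int k \<le> int N" "\<bar>nbr_down y i j - x j\<bar> + int k \<le> int N"
        by (auto simp: nbr_up_def nbr_down_def unit_vec_def)
    qed simp
    also have "\<dots> = (1 - real \<nu> / real d) * ?h (\<sigma> y) + real \<nu> / real d * nbr_avg \<nu> ?h (\<sigma> y)"
      by (rule nbr_avg_coords) fact+
    also have "\<dots> \<le> (1 - real \<nu> / real d) * hit \<nu> {\<lambda>_. 0} (Suc k) (\<sigma> y)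
        + real \<nu> / real d * hit \<nu> {\<lambda>_. 0} (Suc k) (\<sigma> y)"
      using hit_le_Suc[of \<nu> "{\<lambda>_. 0}" k "\<sigma> y"] False * \<open>\<nu> \<le> d\<close>
      by (intro add_mono mult_left_mono) (auto simp: divide_le_eq_1)
    also have "\<dots> = hit \<nu> {\<lambda>_. 0} (Suc k) (\<sigma> y)" by (simp add: algebra_simps)
    finally show ?thesis using False by simp
  qed (use * in simp)
qed simp

lemma return_coset_le:
  assumes J: "J \<subseteq> {..<d}" and "card J = \<nu>" "\<nu> > 0" "k < N"
  shows "nbr_avg d (hit d (same_coset N J x) k) x
    \<le> (1 - real \<nu> / real d) + real \<nu> / real d * return_prob \<nu>"
proof -
  have fin: "finite J" using J finite_subset by blast
  then obtain b where b: "bij_betw b {..<\<nu>} J"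
    using ex_bij_betw_nat_finite[OF fin] assms(2) by (auto simp: lessThan_atLeast0)
  have "\<nu> \<le> d" using J card_mono[OF _ J] assms(2) by simp
  define \<sigma> where "\<sigma> = (\<lambda>(y::nat \<Rightarrow> int) i. if i < \<nu> then y (b i) - x (b i) else 0)"
  have \<sigma>x: "\<sigma> x = (\<lambda>_. 0)" by (simp add: \<sigma>_def fun_eq_iff)
  let ?h = "hit \<nu> {\<lambda>_. 0} k"
  have "nbr_avg d (hit d (same_coset N J x) k) x \<le> nbr_avg d (\<lambda>y. ?h (\<sigma> y)) x"
    unfolding nbr_avg_def
    by (intro divide_right_mono sum_mono add_mono hit_coset_le_hit_origin[OF b J \<open>\<nu> > 0\<close> \<sigma>_def])
       (use \<open>k < N\<close> in \<open>auto simp: nbr_up_def nbr_down_def unit_vec_def\<close>)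
  also have "\<dots> = (1 - real \<nu> / real d) * ?h (\<sigma> x) + real \<nu> / real d * nbr_avg \<nu> ?h (\<sigma> x)"
    by (rule nbr_avg_coords[OF b J \<open>\<nu> > 0\<close> \<sigma>_def])
  \<comment> \<open>A first step along the coset is itself a return, hence the bound 1; for \<nu> =
    d - m this is the summand m/d in \<open>chi\<close>.\<close>
  also have "\<dots> \<le> (1 - real \<nu> / real d) * 1 + real \<nu> / real d * return_prob \<nu>"
    unfolding \<sigma>x using \<open>\<nu> \<le> d\<close> \<open>\<nu> > 0\<close>
    by (intro add_mono mult_left_mono hit_le_1 return_le_return_prob) (auto simp: divide_le_eq_1)
  finally show ?thesis by simp
qed

text \<open>The exponent \<nu> is reduced to 3 only in the factor \<open>m\<close>, which is at most
  1; the constant K may exceed 1 and is raised to the power d instead, so that the result is uniform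
  in \<nu>.\<close>

lemma heat_kernel_pow_le:
  assumes "3 \<le> \<nu>" "\<nu> \<le> d" "N > 0" "s > 0"
  shows "(2 / real N + 3 * sqrt (real d) / sqrt (real s)) ^ \<nu>
    \<le> (2 + 3 * sqrt (real d)) ^ d * (1 / real N ^ 3 + real s powr (-3/2))"
proof -
  define K where "K = 2 + 3 * sqrt (real d)"
  define m where "m = max (1 / real N) (1 / sqrt (real s))"
  have K: "K \<ge> 1" by (simp add: K_def)
  have m: "0 \<le> m" "m \<le> 1" using assms by (auto simp: m_def le_max_iff_disj)
  have "2 / real N + 3 * sqrt (real d) / sqrt (real s) = 2 * (1 / real N) + 3 * sqrt (real d) * (1 / sqrt (real s))"
    by simp
  also have "\<dots> \<le> 2 * m + 3 * sqrt (real d) * m"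
    by (intro add_mono mult_left_mono) (auto simp: m_def)
  finally have "2 / real N + 3 * sqrt (real d) / sqrt (real s) \<le> K * m"
    by (simp add: K_def algebra_simps)
  then have "(2 / real N + 3 * sqrt (real d) / sqrt (real s)) ^ \<nu> \<le> (K * m) ^ \<nu>"
    by (intro power_mono) auto
  also have "\<dots> \<le> K ^ d * m ^ 3"
    unfolding power_mult_distrib
    using K m assms by (intro mult_mono power_increasing power_decreasing) auto
  also have "K ^ d * m ^ 3 \<le> K ^ d * ((1 / real N) ^ 3 + (1 / sqrt (real s)) ^ 3)"
    unfolding m_def max_def using K by (intro mult_left_mono) auto
  also have "(1 / sqrt (real s)) ^ 3 = real s powr (-3/2)"
  proof -
    have "(1 / sqrt (real s)) ^ 3 = (real s powr (- 1 / 2)) powr 3"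
      using assms by (simp add: powr_half_sqrt[symmetric] powr_minus_divide powr_numeral power_one_over)
    also have "\<dots> = real s powr (-3/2)" by (simp add: powr_powr)
    finally show ?thesis .
  qed
  finally show ?thesis by (simp add: K_def power_one_over)
qed

text \<open>Up to a fixed time \<open>n0\<close> the walk cannot wrap around and the lattice return
  probability applies. Later returns are bounded by the sum of the kernel, half of \<eta> for the
  tail of a convergent series and half for the 1/N^3 term.\<close>

lemma eventually_return_coset_le:
  assumes "3 \<le> \<nu>" "\<nu> \<le> d" "\<eta> > 0"
  shows "\<exists>N0\<ge>1. \<forall>N\<ge>N0. \<forall>J x k. J \<subseteq> {..<d} \<longrightarrow> card J = \<nu> \<longrightarrow> k \<le> N\<^sup>2 \<longrightarrow>
    nbr_avg d (hit d (same_coset N J x) k) x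
      \<le> (1 - real \<nu> / real d) + real \<nu> / real d * return_prob \<nu> + \<eta>"
proof -
  define C where "C = 2 * (2 + 3 * sqrt (real d)) ^ d"
  have C: "C > 0" unfolding C_def by (intro mult_pos_pos zero_less_power add_pos_nonneg) auto
  have "summable (\<lambda>s. real s powr (-3/2))" by (subst summable_real_powr_iff) simp
  then obtain n0 where n0: "\<And>m n. m \<ge> n0 \<Longrightarrow> norm (\<Sum>s\<in>{m..<n}. real s powr (-3/2)) < \<eta> / (2 * C)"
    unfolding summable_Cauchy using assms(3) C by (meson divide_pos_pos mult_pos_pos zero_less_numeral)
  \<comment> \<open>Large enough both for \<open>n0 < N\<close> and for C/N \<le> \<eta>/2.\<close>
  define N0 where "N0 = Suc (n0 + nat \<lceil>2 * C / \<eta>\<rceil>)"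
  show ?thesis
  proof (intro exI[of _ N0] conjI allI impI)
    show "N0 \<ge> 1" by (simp add: N0_def)
    fix N J x k assume N: "N0 \<le> N" and J: "J \<subseteq> {..<d}" "card J = \<nu>" and k: "k \<le> N\<^sup>2"
    have N': "n0 < N" "N > 0" using N by (auto simp: N0_def)
    have "2 * C / \<eta> \<le> real N" using N unfolding N0_def by linarith
    then have CN: "C / real N \<le> \<eta> / 2"
      using N'(2) assms(3) by (simp add: field_simps)
    have "d > 0" using assms by simp
    let ?p = "(1 - real \<nu> / real d) + real \<nu> / real d * return_prob \<nu>"
    let ?F = "same_coset N J x"
    show "nbr_avg d (hit d ?F k) x \<le> ?p + \<eta>"
    proof (cases "k \<le> n0")
      case True
      then have "nbr_avg d (hit d ?F k) x \<le> ?p"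
        using J N' assms by (intro return_coset_le) auto
      then show ?thesis using assms(3) by simp
    next
      case False
      have step: "(nbr_avg d ^^ Suc t) (indicator ?F) x
          \<le> C * (1 / real N ^ 3 + real (Suc t) powr (-3/2))" for t
      proof -
        have "(nbr_avg d ^^ Suc t) (indicator ?F) x
            \<le> 2 * (2 / real N + 3 * sqrt (real d) / sqrt (real (Suc t))) ^ card J"
          unfolding same_coset_def by (rule heat_kernel_bound) (use J N' \<open>d > 0\<close> in auto)
        also have "\<dots> \<le> 2 * ((2 + 3 * sqrt (real d)) ^ d * (1 / real N ^ 3 + real (Suc t) powr (-3/2)))"
          unfolding J(2) by (intro mult_left_mono heat_kernel_pow_le) (use assms N' in auto)
        finally show ?thesis by (simp only: C_def mult.assoc)
      qed
      have "nbr_avg d (hit d ?F k) x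
          \<le> nbr_avg d (\<lambda>y. hit d ?F n0 y + (\<Sum>t=n0..<k. (nbr_avg d ^^ t) (indicator ?F) y)) x"
        using False by (intro nbr_avg_mono hit_union_bound) auto
      also have "\<dots> = nbr_avg d (hit d ?F n0) x + (\<Sum>t=n0..<k. (nbr_avg d ^^ Suc t) (indicator ?F) x)"
        by (simp add: nbr_avg_add nbr_avg_sum)
      also have "\<dots> \<le> ?p + (\<Sum>t=n0..<k. C * (1 / real N ^ 3 + real (Suc t) powr (-3/2)))"
        by (intro add_mono sum_mono step return_coset_le) (use J N' assms in auto)
      also have "(\<Sum>t=n0..<k. C * (1 / real N ^ 3 + real (Suc t) powr (-3/2)))
          = C * (real (k - n0) / real N ^ 3) + C * (\<Sum>s=Suc n0..<Suc k. real s powr (-3/2))"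
        by (simp only: sum.shift_bounds_Suc_ivl sum_distrib_left[symmetric] sum.distrib distrib_left)
           (simp)
      also have "C * (real (k - n0) / real N ^ 3) \<le> C * (real (N\<^sup>2) / real N ^ 3)"
        using k C by (intro mult_left_mono divide_right_mono) auto
      also have "\<dots> = C / real N" using N' by (simp add: power2_eq_square power3_eq_cube)
      also have "\<dots> \<le> \<eta> / 2" by (rule CN)
      also have "C * (\<Sum>s=Suc n0..<Suc k. real s powr (-3/2)) \<le> C * (\<eta> / (2 * C))"
        using n0[of "Suc n0" "Suc k"] C by (intro mult_left_mono) auto
      also have "C * (\<eta> / (2 * C)) = \<eta> / 2" using C by simp
      finally show ?thesis by simp
    qed
  qed
qed

lemma nbr_avg_pow_le_torus_sum:
  assumes "N > 0" "d > 0" "periodic N g" "\<And>y. g y \<ge> 0" "N\<^sup>2 \<le> t" "x \<in> lattice_points d"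
  shows "(nbr_avg d ^^ t) g x
    \<le> 2 * (2 + 3 * sqrt (real d)) ^ d / real N ^ d * (\<Sum>y\<in>torus d N. g y)"
proof -
  define K where "K = 2 + 3 * sqrt (real d)"
  let ?I = "\<lambda>y. indicator {u. \<forall>j\<in>{..<d}. int N dvd u j - y j} :: (nat \<Rightarrow> int) \<Rightarrow> real"
  have "N\<^sup>2 > 0" using assms(1) by simp
  with assms(5) have "t > 0" by linarith
  have kernel: "(nbr_avg d ^^ t) (?I y) x \<le> 2 * K ^ d / real N ^ d" for y
  proof -
    have "real N \<le> sqrt (real t)"
      using assms(5) by (intro real_le_rsqrt) (simp flip: of_nat_power)
    then have "2 / real N + 3 * sqrt (real d) / sqrt (real t) \<le> 2 / real N + 3 * sqrt (real d) / real N"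
      using assms by (intro add_left_mono divide_left_mono mult_pos_pos) (auto simp: \<open>t > 0\<close>)
    also have "\<dots> = K / real N" by (simp add: K_def add_divide_distrib)
    finally have "(2 / real N + 3 * sqrt (real d) / sqrt (real t)) ^ d \<le> (K / real N) ^ d"
      by (intro power_mono) auto
    moreover have "(nbr_avg d ^^ t) (?I y) x \<le> 2 * (2 / real N + 3 * sqrt (real d) / sqrt (real t)) ^ d"
      using heat_kernel_bound[of "{..<d}" d N t y x] assms \<open>t > 0\<close> by simp
    ultimately show ?thesis by (simp add: power_divide)
  qed
  have "(nbr_avg d ^^ t) g x \<le> (nbr_avg d ^^ t) (\<lambda>u. \<Sum>y\<in>torus d N. g y * ?I y u) x"
  proof (rule nbr_avg_pow_mono_on[OF _ assms(6)])
    fix u assume u: "u \<in> lattice_points d"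
    let ?y = "torus_proj N u"
    \<comment> \<open>A single summand suffices, the others being nonnegative. Its index lies in
      \<open>torus d N\<close> because \<open>u\<close> is a lattice point; this is why such
      comparisons are restricted to lattice points.\<close>
    have "g u = g ?y * ?I ?y u"
      using periodicD[OF assms(3), of u]
      by (auto simp: indicator_def torus_proj_def mod_eq_dvd_iff[symmetric])
    also have "\<dots> \<le> (\<Sum>y\<in>torus d N. g y * ?I y u)"
      using torus_proj_in_torus[OF assms(1) u] finite_torus assms(4)
      by (intro member_le_sum) auto
    finally show "g u \<le> (\<Sum>y\<in>torus d N. g y * ?I y u)" .
  qed
  also have "\<dots> = (\<Sum>y\<in>torus d N. g y * (nbr_avg d ^^ t) (?I y) x)"
    by (simp add: nbr_avg_pow_sum nbr_avg_pow_cmult)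
  also have "\<dots> \<le> (\<Sum>y\<in>torus d N. g y * (2 * K ^ d / real N ^ d))"
    by (intro sum_mono mult_left_mono kernel assms)
  finally show ?thesis unfolding K_def sum_distrib_right[symmetric] by (simp only: mult.commute)
qed

subsection \<open>Decoupling alternate time blocks\<close>

abbreviation late_blocks :: "nat \<Rightarrow> nat \<Rightarrow> bool list" where
  "late_blocks L n \<equiv> concat (replicate n (replicate L False @ replicate L True))"

abbreviation early_blocks :: "nat \<Rightarrow> nat \<Rightarrow> bool list" where
  "early_blocks L n \<equiv> concat (replicate n (replicate L True @ replicate L False))"

lemma length_early_blocks: "length (early_blocks L n) = 2 * L * n"
  by (induction n) (auto simp: algebra_simps)

lemma map_Not_early_blocks: "map Not (early_blocks L n) = late_blocks L n"
  by (simp add: map_concat)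

text \<open>Delaying one pattern by a single gap gives the other one followed by an idle
  gap.\<close>

lemma early_late_blocks_rotate:
  "replicate L False @ early_blocks L n = late_blocks L n @ replicate L False"
proof (induction n)
  case (Suc n)
  have "replicate L False @ early_blocks L (Suc n)
      = replicate L False @ replicate L True @ (replicate L False @ early_blocks L n)"
    by simp
  also have "\<dots> = late_blocks L (Suc n) @ replicate L False"
    unfolding Suc by simp
  finally show ?case .
qed simp

lemma periodic_mem_lift: "periodic N (\<lambda>x. x \<in> {y. torus_proj N y \<in> A})"
  by (simp add: periodic_def torus_proj_def)

text \<open>The first early block has no gap before it, but the start is stationary: a gap can be
  put in front without changing the sum, and the idle gap at the end fixes the constant 1. Hence
  only late blocks need an estimate.\<close>

lemma sum_early_eq_late:
  fixes A :: "(nat \<Rightarrow> int) set"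
  assumes "N > 0" "d > 0"
  defines "S \<equiv> {y. torus_proj N y \<in> A}"
  shows "(\<Sum>x\<in>torus d N. path_op d c S (early_blocks L n) (\<lambda>_. 1) x)
    = (\<Sum>x\<in>torus d N. path_op d c S (late_blocks L n) (\<lambda>_. 1) x)"
proof -
  have shift: "(\<Sum>x\<in>torus d N. (nbr_avg d ^^ k) g x) = (\<Sum>x\<in>torus d N. g x) \<and> periodic N ((nbr_avg d ^^ k) g)"
    if "periodic N g" for k g
    by (induction k) (use that assms in \<open>auto simp: sum_torus_nbr_avg periodic_nbr_avg\<close>)
  let ?g = "path_op d c S (early_blocks L n) (\<lambda>_. 1)"
  have "periodic N ?g"
    unfolding S_def by (intro periodic_path_op periodic_mem_lift) (simp add: periodic_def)
  then have "(\<Sum>x\<in>torus d N. ?g x) = (\<Sum>x\<in>torus d N. (nbr_avg d ^^ L) ?g x)"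
    using shift by simp
  also have "(nbr_avg d ^^ L) ?g = path_op d c S (replicate L False @ early_blocks L n) (\<lambda>_. 1)"
    by (simp only: path_op_append path_op_False)
  also have "\<dots> = path_op d c S (late_blocks L n) (\<lambda>_. 1)"
    unfolding early_late_blocks_rotate path_op_append path_op_False nbr_avg_pow_const[OF assms(2)] ..
  finally show ?thesis .
qed

text \<open>Replaces independence of the blocks: the bound for one gap and block is uniform in the
  starting point, so the remaining blocks can be pulled out as a constant.\<close>

lemma path_op_late_blocks_le:
  assumes "d > 0" "c \<ge> 0" "\<theta> \<ge> 0"
    and "\<And>x. x \<in> lattice_points d \<Longrightarrow>
      (nbr_avg d ^^ L) (path_op d c S (replicate L True) (\<lambda>_. 1)) x \<le> \<theta>"
    and "x \<in> lattice_points d"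
  shows "path_op d c S (late_blocks L n) (\<lambda>_. 1) x \<le> \<theta> ^ n"
  using assms(5)
proof (induction n arbitrary: x)
  case (Suc n)
  let ?b = "path_op d c S (replicate L False @ replicate L True)"
  have "path_op d c S (late_blocks L (Suc n)) (\<lambda>_. 1) x
      = ?b (path_op d c S (late_blocks L n) (\<lambda>_. 1)) x"
    by (simp add: path_op_append)
  also have "\<dots> \<le> ?b (\<lambda>_. \<theta> ^ n * 1) x"
    using Suc assms(2) by (intro path_op_mono_on) auto
  also have "\<dots> = \<theta> ^ n * ?b (\<lambda>_. 1) x"
    by (simp only: path_op_cmult)
  also have "\<dots> \<le> \<theta> ^ n * \<theta>"
    using assms(3,4) Suc.prems by (intro mult_left_mono) (auto simp: path_op_append path_op_False)
  finally show ?case by (simp add: mult.commute)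
qed simp

lemma gap_visit_block_le:
  fixes A :: "(nat \<Rightarrow> int) set"
  assumes "N > 0" "d > 0" "A \<subseteq> torus d N" "c \<ge> 1" "M \<ge> 0" "x \<in> lattice_points d"
  defines "S \<equiv> {y. torus_proj N y \<in> A}"
  assumes M: "\<And>x j. x \<in> S \<Longrightarrow> j \<le> N\<^sup>2 \<Longrightarrow> path_op d c S (replicate j True) (\<lambda>_. 1) x - 1 \<le> M"
  shows "(nbr_avg d ^^ N\<^sup>2) (path_op d c S (replicate (N\<^sup>2) True) (\<lambda>_. 1)) x
    \<le> 1 + 2 * (2 + 3 * sqrt (real d)) ^ d / real N ^ d * (real (N\<^sup>2) * real (card A) * M)"
proof -
  let ?b = "path_op d c S (replicate (N\<^sup>2) True) (\<lambda>_. 1)"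
  have per: "periodic N (\<lambda>y. ?b y - 1)"
    using periodic_path_op[OF _ periodic_mem_lift, of N "\<lambda>_. 1" d c A "replicate (N\<^sup>2) True"]
    by (simp add: periodic_def S_def)
  \<comment> \<open>Only the excess over 1 passes through the kernel bound. Applied to the whole
    weight, that bound would yield a constant larger than 1 per block, which would compound over the
    blocks.\<close>
  have "?b = (\<lambda>y. 1 + (?b y - 1))" by simp
  then have "(nbr_avg d ^^ N\<^sup>2) ?b = (nbr_avg d ^^ N\<^sup>2) (\<lambda>y. 1 + (?b y - 1))"
    by (rule arg_cong)
  also have "\<dots> = (\<lambda>y. 1 + (nbr_avg d ^^ N\<^sup>2) (\<lambda>y. ?b y - 1) y)"
    using assms(2) by (subst nbr_avg_pow_add) (simp only: nbr_avg_pow_const)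
  finally have "(nbr_avg d ^^ N\<^sup>2) ?b x = 1 + (nbr_avg d ^^ N\<^sup>2) (\<lambda>y. ?b y - 1) x"
    by (rule fun_cong)
  also have "(nbr_avg d ^^ N\<^sup>2) (\<lambda>y. ?b y - 1) x
      \<le> 2 * (2 + 3 * sqrt (real d)) ^ d / real N ^ d * (\<Sum>y\<in>torus d N. ?b y - 1)"
    using assms path_op_ge_1[of d c S] by (intro nbr_avg_pow_le_torus_sum per) auto
  also have "(\<Sum>y\<in>torus d N. ?b y - 1) \<le> real (N\<^sup>2) * real (card A) * M"
    using assms(1-5) M by (intro sum_visit_weight_le) (auto simp: S_def)
  finally show ?thesis by (simp add: divide_right_mono mult_left_mono)
qed

section \<open>The law of the walk and its hitting times\<close>

lemma integral_walk_law:
  fixes f :: "walk_sample \<Rightarrow> real"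
  assumes "N > 0" and [measurable]: "f \<in> borel_measurable (walk_law d N)" and "\<And>\<omega>. \<bar>f \<omega>\<bar> \<le> B"
  shows "integrable (walk_law d N) f"
    "(\<integral>\<omega>. f \<omega> \<partial>walk_law d N)
      = (\<Sum>x\<in>torus d N. \<integral>\<xi>. f (x, \<xi>) \<partial>steps_law d) / real (card (torus d N))"
proof -
  let ?M = "measure_pmf (pmf_of_set (torus d N))"
  interpret S: prob_space "steps_law d" by (rule prob_space_steps_law)
  interpret P: pair_prob_space ?M "steps_law d" by unfold_locales
  show int: "integrable (walk_law d N) f"
    using assms unfolding walk_law_def by (intro P.integrable_const_bound[of _ B]) auto
  have "(\<integral>\<omega>. f \<omega> \<partial>walk_law d N) = (\<integral>x. \<integral>\<xi>. f (x, \<xi>) \<partial>steps_law d \<partial>?M)"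
    using int unfolding walk_law_def by (subst P.integral_fst') auto
  also have "\<dots> = (\<Sum>x\<in>torus d N. \<integral>\<xi>. f (x, \<xi>) \<partial>steps_law d) / real (card (torus d N))"
    using assms finite_torus torus_nonempty by (subst integral_pmf_of_set) auto
  finally show "(\<integral>\<omega>. f \<omega> \<partial>walk_law d N)
      = (\<Sum>x\<in>torus d N. \<integral>\<xi>. f (x, \<xi>) \<partial>steps_law d) / real (card (torus d N))" .
qed

lemma pred_walk_eq [measurable]: "Measurable.pred (walk_law d N) (\<lambda>\<omega>. walk N \<omega> n = x)"
proof -
  have [measurable]: "(\<lambda>\<omega>. fst \<omega> i) \<in> measurable (walk_law d N) (count_space UNIV)" for i
    unfolding walk_law_def by (rule measurable_compose[OF measurable_fst]) simp
  have [measurable]: "(\<lambda>\<omega>. displacement (snd \<omega>) n i) \<in> measurable (walk_law d N) (count_space UNIV)" for i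
    unfolding walk_law_def by (rule measurable_compose[OF measurable_snd]) measurable
  have "(\<lambda>\<omega>. (\<lambda>(a::int) \<omega>. (a + displacement (snd \<omega>) n i) mod int N) (fst \<omega> i) \<omega>)
      \<in> measurable (walk_law d N) (count_space UNIV)" for i
    by (rule measurable_compose_countable) measurable
  then have [measurable]: "(\<lambda>\<omega>. (fst \<omega> i + displacement (snd \<omega>) n i) mod int N)
      \<in> measurable (walk_law d N) (count_space UNIV)" for i by simp
  show ?thesis
    unfolding walk_def torus_proj_def fun_eq_iff by measurable
qed

lemma pred_walk_mem:
  assumes "finite A"
  shows "Measurable.pred (walk_law d N) (\<lambda>\<omega>. walk N \<omega> n \<in> A)"
proof -
  have "(\<lambda>\<omega>. walk N \<omega> n \<in> A) = (\<lambda>\<omega>. \<exists>a\<in>A. walk N \<omega> n = a)" by auto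
  then show ?thesis using assms by (simp only:) measurable
qed

lemma hitting_time_le_iff:
  "ereal_of_enat (hitting_time N \<omega> x) \<le> ereal r \<longleftrightarrow> (\<exists>n. real n \<le> r \<and> walk N \<omega> n = x)"
proof
  assume le: "ereal_of_enat (hitting_time N \<omega> x) \<le> ereal r"
  then have "hitting_time N \<omega> x \<noteq> \<infinity>" by (cases "hitting_time N \<omega> x") auto
  then have "enat ` {n. walk N \<omega> n = x} \<noteq> {}"
    by (auto simp: hitting_time_def Inf_enat_def split: if_splits)
  then obtain k where "k \<in> enat ` {n. walk N \<omega> n = x}" by blast
  then have "hitting_time N \<omega> x \<in> enat ` {n. walk N \<omega> n = x}"
    unfolding hitting_time_def by (rule wellorder_InfI)
  then show "\<exists>n. real n \<le> r \<and> walk N \<omega> n = x" using le by auto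
next
  assume "\<exists>n. real n \<le> r \<and> walk N \<omega> n = x"
  then obtain n where n: "real n \<le> r" "walk N \<omega> n = x" by auto
  then have "hitting_time N \<omega> x \<le> enat n"
    unfolding hitting_time_def by (intro Inf_lower) auto
  then have "ereal_of_enat (hitting_time N \<omega> x) \<le> ereal_of_enat (enat n)"
    by (simp only: ereal_of_enat_le_iff)
  also have "\<dots> \<le> ereal r" using n by simp
  finally show "ereal_of_enat (hitting_time N \<omega> x) \<le> ereal r" .
qed

definition visited_count :: "nat \<Rightarrow> (nat \<Rightarrow> int) set \<Rightarrow> real \<Rightarrow> walk_sample \<Rightarrow> real" where
  "visited_count N A r \<omega> = (\<Sum>x\<in>A. of_bool (ereal_of_enat (hitting_time N \<omega> x) \<le> ereal r))"

lemma borel_measurable_visited_count [measurable]: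
  "visited_count N A r \<in> borel_measurable (walk_law d N)"
  unfolding visited_count_def hitting_time_le_iff by measurable

lemma visited_count_bounds: "0 \<le> visited_count N A r \<omega>" "visited_count N A r \<omega> \<le> real (card A)"
proof -
  show "0 \<le> visited_count N A r \<omega>" unfolding visited_count_def by (intro sum_nonneg) auto
  have "visited_count N A r \<omega> \<le> (\<Sum>x\<in>A. 1)"
    unfolding visited_count_def by (intro sum_mono) auto
  then show "visited_count N A r \<omega> \<le> real (card A)" by simp
qed

lemma visited_count_le_visits:
  assumes "finite A" "\<And>n. real n \<le> r \<Longrightarrow> n < T"
  shows "visited_count N A r \<omega> \<le> real (card {n. n < T \<and> walk N \<omega> n \<in> A})"
proof -
  have "visited_count N A r \<omega> = real (card {x\<in>A. \<exists>n. real n \<le> r \<and> walk N \<omega> n = x})"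
    unfolding visited_count_def hitting_time_le_iff using assms(1)
    by (simp add: of_bool_def sum.If_cases Int_def)
  also have "card {x\<in>A. \<exists>n. real n \<le> r \<and> walk N \<omega> n = x} \<le> card {n. n < T \<and> walk N \<omega> n \<in> A}"
    by (rule surj_card_le[of _ _ "walk N \<omega>"]) (use assms(2) in auto)
  finally show ?thesis by simp
qed

text \<open>The two products collect the visits to \<open>A\<close> in alternate time blocks, and the inequality
  of arithmetic and geometric means decouples them. This is what doubles the exponent.\<close>

lemma exp_visited_count_le:
  assumes "finite A" "l \<ge> 0" "\<And>n. real n \<le> r \<Longrightarrow> n < length bs"
  shows "exp (l * visited_count N A r \<omega>)
    \<le> ((\<Prod>n<length bs. if bs ! n \<and> walk N \<omega> n \<in> A then exp (2 * l) else 1)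
      + (\<Prod>n<length (map Not bs). if map Not bs ! n \<and> walk N \<omega> n \<in> A then exp (2 * l) else 1)) / 2"
    (is "_ \<le> (?a + ?b) / 2")
proof -
  let ?V = "card {n. n < length bs \<and> walk N \<omega> n \<in> A}"
  \<comment> \<open>Each time is marked in exactly one of the two patterns, so the product weights
    every visit once.\<close>
  have "?a * ?b = (\<Prod>n<length bs. if walk N \<omega> n \<in> A then exp (2 * l) else 1)"
    unfolding length_map prod.distrib[symmetric] by (intro prod.cong) auto
  also have "\<dots> = exp (2 * l) ^ ?V"
    by (simp add: prod.If_cases Int_def)
  also have "\<dots> = (exp (l * real ?V))\<^sup>2"
    by (simp add: exp_of_nat_mult[symmetric] exp_double[symmetric] mult_ac)
  finally have ab: "?a * ?b = (exp (l * real ?V))\<^sup>2" .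
  have "exp (l * visited_count N A r \<omega>) \<le> exp (l * real ?V)"
    using visited_count_le_visits[OF assms(1,3)] assms(2) by (simp add: mult_left_mono)
  also have "\<dots> = sqrt (?a * ?b)" unfolding ab by simp
  also have "\<dots> \<le> (?a + ?b) / 2"
    by (intro arith_geo_mean_sqrt prod_nonneg) auto
  finally show ?thesis .
qed

text \<open>J is the complement of the spanning directions: there, all points of A agree modulo
  N.\<close>

lemma coord_subsets_same_coset:
  assumes "A \<in> coord_subsets d N m" "a \<in> A" "N > 0"
  shows "\<exists>J \<subseteq> {..<d}. card J = d - m \<and> {y. torus_proj N y \<in> A} \<subseteq> same_coset N J a"
proof -
  obtain y I where I: "I \<subseteq> {..<d}" "card I = m"
    and A: "A \<subseteq> torus_proj N ` {(\<lambda>j. y j + (\<Sum>i\<in>I. k i * unit_vec i j)) | k. True}"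
    using assms(1) unfolding coord_subsets_def coord_subspaces_def by auto
  have fin: "finite I" using I finite_subset by blast
  have A_mod: "x j = y j mod int N" if x: "x \<in> A" and j: "j \<notin> I" for x j
  proof -
    obtain k where "x = torus_proj N (\<lambda>j. y j + (\<Sum>i\<in>I. k i * unit_vec i j))"
      using A x by blast
    moreover have "(\<Sum>i\<in>I. k i * unit_vec i j) = 0"
      using j by (intro sum.neutral) (auto simp: unit_vec_def)
    ultimately show ?thesis by (simp add: torus_proj_def)
  qed
  show ?thesis
  proof (intro exI[of _ "{..<d} - I"] conjI)
    show "card ({..<d} - I) = d - m" using I fin by (simp add: card_Diff_subset)
    show "{y. torus_proj N y \<in> A} \<subseteq> same_coset N ({..<d} - I) a"
    proof
      fix z assume z: "z \<in> {y. torus_proj N y \<in> A}"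
      have "z j mod int N = a j mod int N" if "j \<notin> I" for j
        using A_mod[of "torus_proj N z" j] A_mod[of a j] that z assms(2)
        by (simp add: torus_proj_def)
      then show "z \<in> same_coset N ({..<d} - I) a"
        by (auto simp: same_coset_def mod_eq_dvd_iff)
    qed
  qed auto
qed

lemma exp_moment_visited_count_le:
  assumes "N > 0" "d > 0" "A \<in> coord_subsets d N m" "l \<ge> 0" "u > 0" "exp (2 * l) * \<rho> < 1"
    and \<rho>: "\<And>J x k. J \<subseteq> {..<d} \<Longrightarrow> card J = d - m \<Longrightarrow> k \<le> N\<^sup>2 \<Longrightarrow>
      nbr_avg d (hit d (same_coset N J x) k) x \<le> \<rho>"
  shows "(\<integral>\<omega>. exp (l * visited_count N A (u * real N ^ d) \<omega>) \<partial>walk_law d N)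
    \<le> exp ((u / 2 + real (N\<^sup>2) / real N ^ d) * (2 * (2 + 3 * sqrt (real d)) ^ d)
        * ((exp (2 * l) - 1) / (1 - exp (2 * l) * \<rho>)) * real (card A))"
proof -
  define c where "c = exp (2 * l)"
  define C where "C = 2 * (2 + 3 * sqrt (real d)) ^ d"
  define M where "M = (c - 1) / (1 - c * \<rho>)"
  define S where "S = {y. torus_proj N y \<in> A}"
  define \<theta> where "\<theta> = 1 + C / real N ^ d * (real (N\<^sup>2) * real (card A) * M)"
  \<comment> \<open>The number of pairs of blocks. \<open>Suc\<close> makes the pattern strictly
    longer than u N^d, and its cost is the summand N^2/N^d of the conclusion.\<close>
  define n where "n = Suc (nat \<lfloor>u * real N ^ d / (2 * real (N\<^sup>2))\<rfloor>)"
  let ?r = "u * real N ^ d"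
  let ?early = "early_blocks (N\<^sup>2) n" and ?late = "late_blocks (N\<^sup>2) n"
  have c: "c \<ge> 1" using assms(4) by (simp add: c_def)
  have C: "C \<ge> 0" by (simp add: C_def)
  have M: "M \<ge> 0" using c assms(6) by (simp add: M_def c_def)
  have \<theta>: "\<theta> \<ge> 0" unfolding \<theta>_def using C M by (intro add_nonneg_nonneg mult_nonneg_nonneg) auto
  have A: "A \<subseteq> torus d N" "A \<noteq> {}" using assms(3) by (auto simp: coord_subsets_def)
  have fin: "finite A" using A finite_torus finite_subset by blast
  have late: "path_op d c S ?late (\<lambda>_. 1) x \<le> \<theta> ^ n" if "x \<in> lattice_points d" for x
  proof (rule path_op_late_blocks_le[OF _ _ \<theta> _ that])
    obtain a where a: "a \<in> A" using A by auto
    obtain J where J: "J \<subseteq> {..<d}" "card J = d - m" "S \<subseteq> same_coset N J a"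
      using coord_subsets_same_coset[OF assms(3) a assms(1)] unfolding S_def by blast
    have visits: "path_op d c S (replicate j True) (\<lambda>_. 1) x - 1 \<le> M" if "j \<le> N\<^sup>2" for x j
    proof -
      have "nbr_avg d (hit d (same_coset N J a) k) z \<le> \<rho>" if "z \<in> S" "k < j" for z k
        using \<rho>[OF J(1,2), of k z] same_coset_eq[of z N J a] J(3) that \<open>j \<le> N\<^sup>2\<close> by auto
      then have "path_op d c S (replicate j True) (\<lambda>_. 1) x - 1 \<le> hit d (same_coset N J a) j x * M"
        unfolding M_def using assms(2,6) J(3) c by (intro visit_weight_le_hit) (auto simp: c_def)
      also have "\<dots> \<le> 1 * M" using M assms(2) by (intro mult_right_mono hit_le_1)
      finally show ?thesis by simp
    qed
    show "(nbr_avg d ^^ N\<^sup>2) (path_op d c S (replicate (N\<^sup>2) True) (\<lambda>_. 1)) x \<le> \<theta>"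
      if "x \<in> lattice_points d" for x
      unfolding \<theta>_def C_def S_def
      by (rule gap_visit_block_le) (use assms A c M that visits in \<open>auto simp: S_def\<close>)
  qed (use assms c in auto)
  have torus_pos: "real (card (torus d N)) > 0"
    using finite_torus torus_nonempty[OF assms(1)] by (simp add: card_gt_0_iff)
  have late_avg: "(\<Sum>x\<in>torus d N. path_op d c S ?late (\<lambda>_. 1) x) / real (card (torus d N)) \<le> \<theta> ^ n"
  proof -
    have "(\<Sum>x\<in>torus d N. path_op d c S ?late (\<lambda>_. 1) x) \<le> (\<Sum>x\<in>torus d N. \<theta> ^ n)"
      using torus_subset_lattice by (intro sum_mono late) auto
    then show ?thesis using torus_pos by (simp add: field_simps)
  qed
  have early_avg: "(\<Sum>x\<in>torus d N. path_op d c S ?early (\<lambda>_. 1) x) / real (card (torus d N)) \<le> \<theta> ^ n"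
    using late_avg sum_early_eq_late[OF assms(1,2)] unfolding S_def by simp
  let ?W = "\<lambda>bs \<omega>. \<Prod>n<length bs. if bs ! n \<and> walk N \<omega> n \<in> A then c else 1"
  have W: "integrable (walk_law d N) (?W bs)"
    "(\<integral>\<omega>. ?W bs \<omega> \<partial>walk_law d N)
      = (\<Sum>x\<in>torus d N. path_op d c S bs (\<lambda>_. 1) x) / real (card (torus d N))" for bs
  proof -
    note [measurable] = pred_walk_mem[OF fin]
    have bd: "\<bar>?W bs \<omega>\<bar> \<le> c ^ length bs" for \<omega>
    proof -
      have "\<bar>?W bs \<omega>\<bar> = (\<Prod>n<length bs. \<bar>if bs ! n \<and> walk N \<omega> n \<in> A then c else 1\<bar>)"
        by (rule abs_prod)
      also have "\<dots> \<le> (\<Prod>n<length bs. c)"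
        by (rule prod_mono) (use c in auto)
      finally show ?thesis by simp
    qed
    have meas: "?W bs \<in> borel_measurable (walk_law d N)" by measurable
    show "integrable (walk_law d N) (?W bs)"
      by (rule integral_walk_law[OF assms(1) meas bd])
    have "(\<integral>\<xi>. ?W bs (x, \<xi>) \<partial>steps_law d) = path_op d c S bs (\<lambda>_. 1) x" for x
      using integral_path_weight[OF assms(2) c pred_displacement_torus[OF fin], of bs x]
      by (simp add: walk_def S_def)
    then show "(\<integral>\<omega>. ?W bs \<omega> \<partial>walk_law d N)
      = (\<Sum>x\<in>torus d N. path_op d c S bs (\<lambda>_. 1) x) / real (card (torus d N))"
      using integral_walk_law(2)[OF assms(1) meas bd] by simp
  qed
  have time: "k < length ?early" if "real k \<le> ?r" for k
  proof -
    have "?r / (2 * real (N\<^sup>2)) < real n" unfolding n_def by linarith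
    then have "?r < 2 * real (N\<^sup>2) * real n" using assms(1) by (simp add: field_simps)
    then have "real k < real (2 * N\<^sup>2 * n)" using that by simp
    then show ?thesis unfolding length_early_blocks by (simp only: of_nat_less_iff)
  qed
  have "(\<integral>\<omega>. exp (l * visited_count N A ?r \<omega>) \<partial>walk_law d N)
      \<le> (\<integral>\<omega>. (?W ?early \<omega> + ?W (map Not ?early) \<omega>) / 2 \<partial>walk_law d N)"
  proof (rule integral_mono)
    show "integrable (walk_law d N) (\<lambda>\<omega>. exp (l * visited_count N A ?r \<omega>))"
      by (rule integral_walk_law[OF assms(1), where B = "exp (l * real (card A))"])
         (use visited_count_bounds(2) assms(4) in \<open>auto intro!: mult_left_mono\<close>)
    show "integrable (walk_law d N) (\<lambda>\<omega>. (?W ?early \<omega> + ?W (map Not ?early) \<omega>) / 2)"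
      by (intro integrable_divide Bochner_Integration.integrable_add W)
    show "exp (l * visited_count N A ?r \<omega>) \<le> (?W ?early \<omega> + ?W (map Not ?early) \<omega>) / 2" for \<omega>
      unfolding c_def by (rule exp_visited_count_le[OF fin assms(4) time])
  qed
  also have "\<dots> = ((\<integral>\<omega>. ?W ?early \<omega> \<partial>walk_law d N) + (\<integral>\<omega>. ?W ?late \<omega> \<partial>walk_law d N)) / 2"
    unfolding map_Not_early_blocks integral_divide_zero
    by (subst Bochner_Integration.integral_add[OF W(1) W(1)]) (rule refl)
  also have "\<dots> \<le> \<theta> ^ n"
    using early_avg late_avg unfolding W(2) by simp
  \<comment> \<open>By 1 + y \<le> exp(y) the contributions of the blocks add up in the
    exponent.\<close>
  also have "\<dots> \<le> exp (C / real N ^ d * (real (N\<^sup>2) * real (card A) * M)) ^ n"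
    unfolding \<theta>_def[symmetric] using \<theta> unfolding \<theta>_def by (intro power_mono exp_ge_add_one_self)
  also have "\<dots> = exp (real n * (real (N\<^sup>2) / real N ^ d) * (C * M * real (card A)))"
    by (simp add: exp_of_nat_mult[symmetric] mult_ac)
  also have "\<dots> \<le> exp ((u / 2 + real (N\<^sup>2) / real N ^ d) * (C * M * real (card A)))"
  proof -
    have "real n \<le> ?r / (2 * real (N\<^sup>2)) + 1"
      using assms(5) unfolding n_def by simp
    then have "real n * (real (N\<^sup>2) / real N ^ d)
        \<le> (?r / (2 * real (N\<^sup>2)) + 1) * (real (N\<^sup>2) / real N ^ d)"
      by (intro mult_right_mono) auto
    also have "\<dots> = u / 2 + real (N\<^sup>2) / real N ^ d"
      using assms(1) by (simp add: field_simps)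
    finally have "real n * (real (N\<^sup>2) / real N ^ d) * (C * M * real (card A))
        \<le> (u / 2 + real (N\<^sup>2) / real N ^ d) * (C * M * real (card A))"
      using C M by (intro mult_right_mono mult_nonneg_nonneg) auto
    then show ?thesis by (simp only: exp_le_cancel_iff)
  qed
  finally show ?thesis by (simp add: C_def M_def c_def mult.assoc)
qed

lemma eventually_exp_moment_visited_count_le:
  assumes "d \<ge> 4" "1 \<le> m" "m \<le> d - 3" "l > 0" "chi d m l < 1" "u > 0"
  shows "\<exists>N0\<ge>1. \<forall>N\<ge>N0. \<forall>A\<in>coord_subsets d N m.
    (\<integral>\<omega>. exp (l * visited_count N A (u * real N ^ d) \<omega>) \<partial>walk_law d N)
      \<le> exp (real (card A) *
          (4 * (2 + 3 * sqrt (real d)) ^ d * u * ((exp (2 * l) - 1) / (1 - chi d m l))))"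
proof -
  \<comment> \<open>With this choice exp(2 l) \<rho> is the midpoint of \<chi> and 1, so the
    denominator loses exactly a factor 2.\<close>
  define \<eta> where "\<eta> = (1 - chi d m l) / (2 * exp (2 * l))"
  define K where "K = (2 + 3 * sqrt (real d)) ^ d"
  define \<rho> where "\<rho> = (1 - real (d - m) / real d) + real (d - m) / real d * return_prob (d - m) + \<eta>"
  have "\<eta> > 0" using assms by (simp add: \<eta>_def)
  have "real (d - m) / real d = 1 - real m / real d"
    using assms by (simp add: of_nat_diff diff_divide_distrib)
  then have "exp (2 * l) * \<rho> = chi d m l + exp (2 * l) * \<eta>"
    by (simp add: \<rho>_def chi_def distrib_left)
  moreover have "exp (2 * l) * \<eta> = (1 - chi d m l) / 2"
    by (simp add: \<eta>_def)
  ultimately have gap: "1 - exp (2 * l) * \<rho> = (1 - chi d m l) / 2"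
    by (simp add: field_simps)
  have "3 \<le> d - m" "d - m \<le> d" using assms by auto
  obtain N1 where N1: "N1 \<ge> 1" "\<And>N J x k. N \<ge> N1 \<Longrightarrow> J \<subseteq> {..<d} \<Longrightarrow> card J = d - m \<Longrightarrow> k \<le> N\<^sup>2 \<Longrightarrow>
      nbr_avg d (hit d (same_coset N J x) k) x \<le> \<rho>"
    using eventually_return_coset_le[OF \<open>3 \<le> d - m\<close> \<open>d - m \<le> d\<close> \<open>\<eta> > 0\<close>]
    unfolding \<rho>_def[symmetric] by blast
  show ?thesis
  \<comment> \<open>N \<ge> 2/u makes the rounding term at most 1/N \<le> u/2. Neither threshold
    depends on A, so the bound passes to the supremum.\<close>
  proof (intro exI[of _ "max N1 (nat \<lceil>2 / u\<rceil>)"] conjI allI impI ballI)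
    fix N A assume N: "max N1 (nat \<lceil>2 / u\<rceil>) \<le> N" and A: "A \<in> coord_subsets d N m"
    have "N > 0" using N N1 by simp
    have "2 / u \<le> real N" using N by linarith
    have "real (N\<^sup>2) / real N ^ d \<le> real (N\<^sup>2) / real N ^ 3"
      using \<open>N > 0\<close> assms(1) by (intro divide_left_mono power_increasing) auto
    also have "\<dots> = 1 / real N" using \<open>N > 0\<close> by (simp add: power2_eq_square power3_eq_cube)
    also have "\<dots> \<le> u / 2" using \<open>2 / u \<le> real N\<close> \<open>N > 0\<close> assms(6) by (simp add: field_simps)
    finally have small: "u / 2 + real (N\<^sup>2) / real N ^ d \<le> u" by linarith
    have "(\<integral>\<omega>. exp (l * visited_count N A (u * real N ^ d) \<omega>) \<partial>walk_law d N)
      \<le> exp ((u / 2 + real (N\<^sup>2) / real N ^ d) * (2 * K)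
        * ((exp (2 * l) - 1) / (1 - exp (2 * l) * \<rho>)) * real (card A))"
      unfolding K_def
      by (rule exp_moment_visited_count_le[OF \<open>N > 0\<close> _ A _ assms(6) _ N1(2)])
         (use assms N gap in auto)
    also have "\<dots> \<le> exp (u * (2 * K) * ((exp (2 * l) - 1) / ((1 - chi d m l) / 2)) * real (card A))"
      unfolding gap exp_le_cancel_iff
      using assms small by (intro mult_right_mono) (auto simp: K_def)
    also have "u * (2 * K) * ((exp (2 * l) - 1) / ((1 - chi d m l) / 2)) * real (card A)
        = real (card A) * (4 * K * u * ((exp (2 * l) - 1) / (1 - chi d m l)))"
      by simp
    finally show "(\<integral>\<omega>. exp (l * visited_count N A (u * real N ^ d) \<omega>) \<partial>walk_law d N)
      \<le> exp (real (card A) *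
          (4 * (2 + 3 * sqrt (real d)) ^ d * u * ((exp (2 * l) - 1) / (1 - chi d m l))))"
      unfolding K_def .
  qed (use N1 in auto)
qed

section \<open>The covering probability and the conclusion\<close>

lemma prob_space_walk_law: "prob_space (walk_law d N)"
proof -
  interpret S: prob_space "steps_law d" by (rule prob_space_steps_law)
  interpret P: pair_prob_space "measure_pmf (pmf_of_set (torus d N))" "steps_law d" by unfold_locales
  show ?thesis unfolding walk_law_def by (rule P.prob_space_axioms)
qed

lemma integrable_exp_visited_count:
  assumes "l \<ge> 0"
  shows "integrable (walk_law d N) (\<lambda>\<omega>. exp (l * visited_count N A r \<omega>))"
proof -
  interpret prob_space "walk_law d N" by (rule prob_space_walk_law)
  show ?thesis
    by (rule integrable_const_bound[where B = "exp (l * real (card A))"])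
       (use visited_count_bounds(2) assms in \<open>auto intro!: mult_left_mono\<close>)
qed

text \<open>Exponential Markov inequality: on the covering event the count attains its maximum
  |A|.\<close>

lemma prob_cover_le:
  assumes "finite A" "l \<ge> 0"
  shows "\<P>(\<omega> in walk_law d N. A \<subseteq> walk_range N \<omega> r)
    \<le> exp (- l * real (card A)) * (\<integral>\<omega>. exp (l * visited_count N A r \<omega>) \<partial>walk_law d N)"
proof -
  interpret prob_space "walk_law d N" by (rule prob_space_walk_law)
  define E where "E = {\<omega> \<in> space (walk_law d N). A \<subseteq> walk_range N \<omega> r}"
  have sub: "A \<subseteq> walk_range N \<omega> r \<longleftrightarrow> (\<forall>x\<in>A. \<exists>n. real n \<le> r \<and> walk N \<omega> n = x)" for \<omega>
    by (auto simp: walk_range_def)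
  have E [measurable]: "E \<in> events" unfolding E_def sub using assms(1) by measurable
  have "visited_count N A r \<omega> = real (card A)" if "\<omega> \<in> E" for \<omega>
  proof -
    have "visited_count N A r \<omega> = (\<Sum>x\<in>A. 1)"
      unfolding visited_count_def hitting_time_le_iff
      using that by (intro sum.cong) (auto simp: E_def sub)
    then show ?thesis by simp
  qed
  then have "exp (l * real (card A)) * indicator E \<omega> \<le> exp (l * visited_count N A r \<omega>)" for \<omega>
    by (auto simp: indicator_def)
  then have "(\<integral>\<omega>. exp (l * real (card A)) * indicator E \<omega> \<partial>walk_law d N)
      \<le> (\<integral>\<omega>. exp (l * visited_count N A r \<omega>) \<partial>walk_law d N)"
    using assms(2) by (intro integral_mono integrable_exp_visited_count) (auto simp: emeasure_eq_measure)
  then have "exp (l * real (card A)) * prob E \<le> (\<integral>\<omega>. exp (l * visited_count N A r \<omega>) \<partial>walk_law d N)"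
    by simp
  then show ?thesis
    unfolding E_def[symmetric] by (simp add: exp_minus field_simps)
qed

text \<open>The condition on \<chi> is open. The larger rate is needed because Markov's inequality
  at \<open>l\<close> itself leaves a factor exp of a positive multiple of |A|.\<close>

lemma exists_larger_rate:
  assumes "chi d m l < 1"
  shows "\<exists>l'>l. chi d m l' < 1"
proof -
  have "((\<lambda>s. chi d m s) \<longlongrightarrow> chi d m l) (at_right l)"
    unfolding chi_def by (intro tendsto_intros)
  then have "\<forall>\<^sub>F s in at_right l. chi d m s < 1"
    using assms by (rule order_tendstoD)
  then have "\<forall>\<^sub>F s in at_right l. chi d m s < 1 \<and> l < s"
    using eventually_at_right_less[of l] by eventually_elim simp
  then show ?thesis
    using eventually_happens'[OF trivial_limit_at_right_real] by blast
qed

theorem theorem2p1: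
  fixes d :: nat
  assumes "d \<ge> 4"
  shows "\<exists>c5::real. c5 > 0 \<and>
    (\<forall>(m::nat) (l::real). 1 \<le> m \<and> m \<le> d - 3 \<and> l > 0 \<and> chi d m l < 1 \<longrightarrow>
      (\<forall>u::real. u > 0 \<longrightarrow>
        limsup (\<lambda>N. SUP A\<in>coord_subsets d N m.
          ereal (1 / real (card A) *
            ln (\<integral>\<omega>. exp (l * (\<Sum>x\<in>A. of_bool
                  (ereal_of_enat (hitting_time N \<omega> x) \<le> ereal (u * real N ^ d))))
                \<partial>walk_law d N)))
        \<le> ereal (c5 * u * ((exp (2 * l) - 1) / (1 - chi d m l)))) \<and>
      (\<exists>(N1::nat) (u1::real). N1 \<ge> 1 \<and> u1 > 0 \<and>
        (\<forall>N\<ge>N1. \<forall>A\<in>coord_subsets d N m.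
          \<P>(\<omega> in walk_law d N. A \<subseteq> walk_range N \<omega> (u1 * real N ^ d))
            \<le> exp (- l * real (card A)))))"
proof -
  \<comment> \<open>The kernel bound gives 2 (2 + 3 sqrt d)^d and the halved denominator another 2;
    the number of block pairs, u/2 plus a rounding term of at most u/2, gives the factor u.\<close>
  define c5 where "c5 = 4 * (2 + 3 * sqrt (real d)) ^ d"
  have c5: "c5 > 0" unfolding c5_def by (intro mult_pos_pos zero_less_power add_pos_nonneg) auto
  have fin: "finite A" "card A > 0" if "A \<in> coord_subsets d N m" for A N m
    using that finite_subset[OF _ finite_torus] by (auto simp: coord_subsets_def card_gt_0_iff)
  show ?thesis
    unfolding visited_count_def[symmetric]
  proof (intro exI[of _ c5] conjI allI impI c5; elim conjE)
    fix m :: nat and l u :: real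
    assume m: "1 \<le> m" "m \<le> d - 3" and l: "l > 0" "chi d m l < 1" and u: "u > 0"
    let ?B = "c5 * u * ((exp (2 * l) - 1) / (1 - chi d m l))"
    obtain N0 where N0: "\<And>N A. N \<ge> N0 \<Longrightarrow> A \<in> coord_subsets d N m \<Longrightarrow>
        (\<integral>\<omega>. exp (l * visited_count N A (u * real N ^ d) \<omega>) \<partial>walk_law d N) \<le> exp (real (card A) * ?B)"
      using eventually_exp_moment_visited_count_le[OF assms m l u] unfolding c5_def by blast
    show "limsup (\<lambda>N. SUP A\<in>coord_subsets d N m. ereal (1 / real (card A) *
        ln (\<integral>\<omega>. exp (l * visited_count N A (u * real N ^ d) \<omega>) \<partial>walk_law d N))) \<le> ereal ?B"
    proof (rule Limsup_bounded, rule eventually_sequentiallyI[of N0], rule SUP_least)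
      fix N A assume "N0 \<le> N" and A: "A \<in> coord_subsets d N m"
      interpret prob_space "walk_law d N" by (rule prob_space_walk_law)
      let ?I = "\<integral>\<omega>. exp (l * visited_count N A (u * real N ^ d) \<omega>) \<partial>walk_law d N"
      \<comment> \<open>The exponent is nonnegative; this keeps the argument of \<open>ln\<close>
        positive.\<close>
      have "?I \<ge> 1"
        using l visited_count_bounds(1)
        by (intro integral_ge_const integrable_exp_visited_count) auto
      then have "ln ?I \<le> ln (exp (real (card A) * ?B))"
        using N0[OF \<open>N0 \<le> N\<close> A] by (intro ln_mono) auto
      then have "1 / real (card A) * ln ?I \<le> ?B"
        using fin[OF A] by (simp add: divide_le_eq mult.commute)
      then show "ereal (1 / real (card A) * ln ?I) \<le> ereal ?B" by simp
    qed
  next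
    fix m :: nat and l :: real
    assume m: "1 \<le> m" "m \<le> d - 3" and l: "l > 0" "chi d m l < 1"
    obtain l' where l': "l' > l" "chi d m l' < 1" using exists_larger_rate[OF l(2)] by blast
    define M where "M = c5 * ((exp (2 * l') - 1) / (1 - chi d m l'))"
    have M: "M > 0" using c5 l l' by (auto simp: M_def)
    \<comment> \<open>Chosen so that the moment bound at rate \<open>l'\<close> is exactly exp((l' -
      l) |A|), the room that Markov's inequality leaves.\<close>
    define u1 where "u1 = (l' - l) / M"
    have u1: "u1 > 0" using M l' by (simp add: u1_def)
    obtain N1 where N1: "N1 \<ge> 1" "\<And>N A. N \<ge> N1 \<Longrightarrow> A \<in> coord_subsets d N m \<Longrightarrow>
        (\<integral>\<omega>. exp (l' * visited_count N A (u1 * real N ^ d) \<omega>) \<partial>walk_law d N)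
          \<le> exp (real (card A) * (c5 * u1 * ((exp (2 * l') - 1) / (1 - chi d m l'))))"
      using eventually_exp_moment_visited_count_le[OF assms m _ l'(2) u1] l l' unfolding c5_def by auto
    have "c5 * u1 * ((exp (2 * l') - 1) / (1 - chi d m l')) = u1 * M" by (simp add: M_def)
    also have "\<dots> = l' - l" using M by (simp add: u1_def)
    finally have rate: "c5 * u1 * ((exp (2 * l') - 1) / (1 - chi d m l')) = l' - l" .
    show "\<exists>N1 u1. N1 \<ge> 1 \<and> u1 > 0 \<and> (\<forall>N\<ge>N1. \<forall>A\<in>coord_subsets d N m.
        \<P>(\<omega> in walk_law d N. A \<subseteq> walk_range N \<omega> (u1 * real N ^ d)) \<le> exp (- l * real (card A)))"
    proof (intro exI[of _ N1] exI[of _ u1] conjI N1(1) u1 allI impI ballI)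
      fix N A assume N: "N1 \<le> N" and A: "A \<in> coord_subsets d N m"
      have "\<P>(\<omega> in walk_law d N. A \<subseteq> walk_range N \<omega> (u1 * real N ^ d))
          \<le> exp (- l' * real (card A))
            * (\<integral>\<omega>. exp (l' * visited_count N A (u1 * real N ^ d) \<omega>) \<partial>walk_law d N)"
        using l l' by (intro prob_cover_le fin[OF A]) auto
      also have "\<dots> \<le> exp (- l' * real (card A)) * exp (real (card A) * (l' - l))"
        using N1(2)[OF N A] unfolding rate by (intro mult_left_mono) auto
      also have "\<dots> = exp (- l * real (card A))"
        by (simp add: exp_add[symmetric] algebra_simps)
      finally show "\<P>(\<omega> in walk_law d N. A \<subseteq> walk_range N \<omega> (u1 * real N ^ d)) \<le> exp (- l * real (card A))" .
    qed
  qed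
qed

end
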